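(* Let $\mathbb{K}$ be a d-minimal expansion of an ordered field and let $\mathbb{G}$ be an Abelian group definable in $\mathbb{K}$. If $\mathbb{G}$ is definably connected, then $\mathbb{G}$ is divisible.
   Context: "Definable" means definable in $\mathbb{K}$ with parameters. $\mathbb{K}$ is a first-order expansion of an ordered field. It is definably complete if every definable subset of $\mathbb{K}$ has a supremum in $\mathbb{K}\cup\{\pm\infty\}$. It is d-minimal if it is definably complete and every definable set $X \subseteq \mathbb{K}$ is the union of an open set and finitely many discrete sets, where the number of discrete sets does not depend on the parameters used to define $X$. A definable set $X\subseteq \mathbb{K}^n$ is an embedded $\mathcal{C}^k$-manifold of dimension $d$ if for every $x \in X$ there is an open box $U\ni x$ such that, after a permutation of coordinates, $X\cap U$ is the graph of a $\mathcal{C}^k$-function $f:V\to W$, where $V\subseteq \mathbb{K}^d$, $W\subseteq\mathbb{K}^{n-d}$ are the boxes with $U=V\times W$. A finitary $\mathcal{C}^k$-manifold is a definable set $X$ with a topology $\tau$, finitely many definable embedded $\mathcal{C}^k$-manifolds $C_1,\dots,C_m$ of the same dimension and definable maps $f_i: C_i\to X$, each a homeomorphism onto a $\tau$-open subset, with $X=\bigcup_i f_i(C_i)$ and all $f_i^{-1}\circ f_j$ of class $\mathcal{C}^k$. Every definable group $\mathbb{G}$ carries, for each $k\in\mathbb{N}$, a unique structure of finitary $\mathcal{C}^k$-manifold for which multiplication and inversion are $\mathcal{C}^k$; the underlying topology (the same for all $k$) is called the group manifold topology. $\mathbb{G}$ is definably connected if, in its group manifold topology, it has no definable clopen subsets other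 than $\emptyset$ and $G$. *)

theory Defs
  imports "HOL-Analysis.Analysis" "HOL-Algebra.Group" "HOL-Combinatorics.Permutations"
begin

section \<open>First-order expansions of an ordered field\<close>

text \<open>The language is that of ordered rings together with new function symbols \<open>'f\<close> and
  new relation symbols \<open>'r\<close>.  A new symbol applied to a list of length \<open>n\<close> is
  an \<open>n\<close>-ary symbol (constants are the case \<open>n = 0\<close>), so no separate arity
  function is needed.  Variables are de Bruijn indices.\<close>

datatype 'f trm =
    Var nat | Zero | One
  | Add "'f trm" "'f trm" | Minus "'f trm" | Times "'f trm" "'f trm"
  | Fn 'f "'f trm list"

datatype ('f, 'r) form =
    Eq "'f trm" "'f trm" | Less "'f trm" "'f trm" | Rel 'r "'f trm list"
  | Neg "('f, 'r) form" | Conj "('f, 'r) form" "('f, 'r) form" | Exists "('f, 'r) form"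

record ('f, 'r, 'k) expansion =
  fn_interp :: "'f \<Rightarrow> 'k list \<Rightarrow> 'k"
  rel_interp :: "'r \<Rightarrow> 'k list \<Rightarrow> bool"

primrec trm_val ::
  "('f, 'r, 'k::linordered_field) expansion \<Rightarrow> (nat \<Rightarrow> 'k) \<Rightarrow> 'f trm \<Rightarrow> 'k" where
  "trm_val M e (Var i) = e i"
| "trm_val M e Zero = 0"
| "trm_val M e One = 1"
| "trm_val M e (Add s t) = trm_val M e s + trm_val M e t"
| "trm_val M e (Minus t) = - trm_val M e t"
| "trm_val M e (Times s t) = trm_val M e s * trm_val M e t"
| "trm_val M e (Fn f ts) = fn_interp M f (map (trm_val M e) ts)"

primrec sat ::
  "('f, 'r, 'k::linordered_field) expansion \<Rightarrow> (nat \<Rightarrow> 'k) \<Rightarrow> ('f, 'r) form \<Rightarrow> bool" where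
  "sat M e (Eq s t) \<longleftrightarrow> trm_val M e s = trm_val M e t"
| "sat M e (Less s t) \<longleftrightarrow> trm_val M e s < trm_val M e t"
| "sat M e (Rel r ts) \<longleftrightarrow> rel_interp M r (map (trm_val M e) ts)"
| "sat M e (Neg \<phi>) \<longleftrightarrow> \<not> sat M e \<phi>"
| "sat M e (Conj \<phi> \<psi>) \<longleftrightarrow> sat M e \<phi> \<and> sat M e \<psi>"
| "sat M e (Exists \<phi>) \<longleftrightarrow> (\<exists>a. sat M (case_nat a e) \<phi>)"


section \<open>Definable sets and maps\<close>

text \<open>Points of \<open>K\<^sup>n\<close> are lists of length \<open>n\<close>; the product of
  \<open>K\<^sup>m\<close> and \<open>K\<^sup>n\<close> is identified with \<open>K\<^bsup>m+n\<^esup>\<close> by appending.\<close>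

definition Kn :: "nat \<Rightarrow> 'k list set" where
  "Kn n = {x. length x = n}"

text \<open>The variables \<open>0, \<dots>, n - 1\<close> are evaluated at the point of \<open>K\<^sup>n\<close>, all later
  ones at the parameters \<open>p 0, p 1, \<dots>\<close>, of which a formula uses only finitely many.\<close>

definition assign :: "'k list \<Rightarrow> (nat \<Rightarrow> 'k) \<Rightarrow> nat \<Rightarrow> 'k" where
  "assign x p i = (if i < length x then x ! i else p (i - length x))"

definition def_set ::
  "('f, 'r, 'k::linordered_field) expansion \<Rightarrow> nat \<Rightarrow> ('f, 'r) form \<Rightarrow> (nat \<Rightarrow> 'k) \<Rightarrow> 'k list set"
  where "def_set M n \<phi> p = {x \<in> Kn n. sat M (assign x p) \<phi>}"

definition definable ::
  "('f, 'r, 'k::linordered_field) expansion \<Rightarrow> nat \<Rightarrow> 'k list set \<Rightarrow> bool" where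
  "definable M n X \<longleftrightarrow> (\<exists>\<phi> p. X = def_set M n \<phi> p)"

definition definable_map ::
  "('f, 'r, 'k::linordered_field) expansion \<Rightarrow> nat \<Rightarrow> nat \<Rightarrow> 'k list set \<Rightarrow> ('k list \<Rightarrow> 'k list) \<Rightarrow> bool"
  where
  "definable_map M m n X f \<longleftrightarrow>
     X \<subseteq> Kn m \<and> f ` X \<subseteq> Kn n \<and> definable M (m + n) {x @ f x | x. x \<in> X}"


section \<open>Topology\<close>

definition open_interval :: "'k::linorder set \<Rightarrow> bool" where
  "open_interval I \<longleftrightarrow>
     (\<exists>a b. I = {a<..<b}) \<or> (\<exists>a. I = {a<..}) \<or> (\<exists>b. I = {..<b}) \<or> I = UNIV"

definition open_box :: "nat \<Rightarrow> 'k::linorder list set \<Rightarrow> bool" where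
  "open_box n B \<longleftrightarrow>
     (\<exists>I. (\<forall>i<n. open_interval (I i)) \<and> B = {x \<in> Kn n. \<forall>i<n. x ! i \<in> I i})"

definition Kn_top :: "nat \<Rightarrow> 'k::linorder list topology" where
  "Kn_top n = topology_generated_by {B. open_box n B}"

definition discrete_subset :: "nat \<Rightarrow> 'k::linorder list set \<Rightarrow> bool" where
  "discrete_subset n D \<longleftrightarrow> D \<subseteq> Kn n \<and> subtopology (Kn_top n) D = discrete_topology D"


section \<open>Definable completeness and d-minimality\<close>

text \<open>The supremum of the empty set is \<open>- \<infinity>\<close> and that of a set not bounded above is
  \<open>+ \<infinity>\<close>, so only the remaining sets impose a condition.\<close>

definition definably_complete :: "('f, 'r, 'k::linordered_field) expansion \<Rightarrow> bool" where
  "definably_complete M \<longleftrightarrow>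
     (\<forall>X. definable M 1 X \<longrightarrow>
        (let S = {a. [a] \<in> X} in
           S \<noteq> {} \<and> bdd_above S \<longrightarrow>
           (\<exists>s. (\<forall>a\<in>S. a \<le> s) \<and> (\<forall>u. (\<forall>a\<in>S. a \<le> u) \<longrightarrow> s \<le> u))))"

definition d_minimal :: "('f, 'r, 'k::linordered_field) expansion \<Rightarrow> bool" where
  "d_minimal M \<longleftrightarrow> definably_complete M \<and>
     (\<forall>\<phi>. \<exists>N::nat. \<forall>p. \<exists>U D. openin (Kn_top 1) U \<and> (\<forall>i<N. discrete_subset 1 (D i)) \<and>
        def_set M 1 \<phi> p = U \<union> (\<Union>i<N. D i))"


section \<open>Functions of class $C^k$\<close>

definition l1_dist :: "nat \<Rightarrow> 'k::linordered_field list \<Rightarrow> 'k list \<Rightarrow> 'k" where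
  "l1_dist d x y = (\<Sum>i<d. \<bar>x ! i - y ! i\<bar>)"

definition has_gradient ::
  "nat \<Rightarrow> 'k::linordered_field list set \<Rightarrow> ('k list \<Rightarrow> 'k) \<Rightarrow> 'k list \<Rightarrow> (nat \<Rightarrow> 'k) \<Rightarrow> bool" where
  "has_gradient d U g x c \<longleftrightarrow>
     (\<forall>\<epsilon>>0. \<exists>\<delta>>0. \<forall>y\<in>U. l1_dist d y x < \<delta> \<longrightarrow>
        \<bar>g y - g x - (\<Sum>i<d. c i * (y ! i - x ! i))\<bar> \<le> \<epsilon> * l1_dist d y x)"

text \<open>Used only for open \<open>U\<close>, where the gradient, if it exists, is the vector
  of partial derivatives.\<close>

primrec Ck_scalar ::
  "nat \<Rightarrow> nat \<Rightarrow> 'k::linordered_field list set \<Rightarrow> ('k list \<Rightarrow> 'k) \<Rightarrow> bool" where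
  "Ck_scalar d 0 U g \<longleftrightarrow>
     continuous_map (subtopology (Kn_top d) U) (Kn_top 1) (\<lambda>x. [g x])"
| "Ck_scalar d (Suc k) U g \<longleftrightarrow>
     (\<exists>h. (\<forall>x\<in>U. has_gradient d U g x (\<lambda>i. h i x)) \<and> (\<forall>i<d. Ck_scalar d k U (h i)))"

definition Ck_open ::
  "nat \<Rightarrow> nat \<Rightarrow> nat \<Rightarrow> 'k::linordered_field list set \<Rightarrow> ('k list \<Rightarrow> 'k list) \<Rightarrow> bool" where
  "Ck_open k d m U f \<longleftrightarrow> f ` U \<subseteq> Kn m \<and> (\<forall>j<m. Ck_scalar d k U (\<lambda>x. f x ! j))"

text \<open>A map on a (relatively open subset of an) embedded manifold is of class $C^k$ if it
  extends locally to a definable $C^k$ map on an open subset of the ambient space.  In a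
  chart where the manifold is the graph of \<open>f : V \<rightarrow> W\<close> this says that the map is $C^k$ as
  a function of \<open>v \<in> V\<close>.\<close>

definition Ck_map ::
  "('f, 'r, 'k::linordered_field) expansion \<Rightarrow> nat \<Rightarrow> nat \<Rightarrow> nat \<Rightarrow> 'k list set \<Rightarrow>
   ('k list \<Rightarrow> 'k list) \<Rightarrow> bool" where
  "Ck_map M k n m A g \<longleftrightarrow> A \<subseteq> Kn n \<and>
     (\<forall>x\<in>A. \<exists>U h. open_box n U \<and> x \<in> U \<and> definable_map M n m U h \<and> Ck_open k n m U h \<and>
        (\<forall>y\<in>A \<inter> U. h y = g y))"


section \<open>Embedded and finitary manifolds\<close>

definition embedded_manifold ::
  "('f, 'r, 'k::linordered_field) expansion \<Rightarrow> nat \<Rightarrow> nat \<Rightarrow> nat \<Rightarrow> 'k list set \<Rightarrow> bool" where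
  "embedded_manifold M k n d X \<longleftrightarrow> d \<le> n \<and> definable M n X \<and>
     (\<forall>x\<in>X. \<exists>U V W \<sigma> f. open_box n U \<and> x \<in> U \<and> \<sigma> permutes {..<n} \<and>
        open_box d V \<and> open_box (n - d) W \<and>
        permute_list \<sigma> ` U = {v @ w | v w. v \<in> V \<and> w \<in> W} \<and>
        f ` V \<subseteq> W \<and> Ck_open k d (n - d) V f \<and>
        permute_list \<sigma> ` (X \<inter> U) = {v @ f v | v. v \<in> V})"

text \<open>A parametrization: a subset \<open>pdom\<close> of \<open>K\<^bsup>pdim\<^esup>\<close> and a map defined on it.\<close>

record 'k param =
  pdim :: nat
  pdom :: "'k list set"
  pmap :: "'k list \<Rightarrow> 'k list"

abbreviation pimg :: "'k param \<Rightarrow> 'k list set" where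
  "pimg c \<equiv> pmap c ` pdom c"

abbreviation pinv :: "'k param \<Rightarrow> 'k list \<Rightarrow> 'k list" where
  "pinv c \<equiv> inv_into (pdom c) (pmap c)"

definition Ck_in_charts ::
  "('f, 'r, 'k::linordered_field) expansion \<Rightarrow> nat \<Rightarrow> 'k param set \<Rightarrow> 'k param set \<Rightarrow>
   ('k list \<Rightarrow> 'k list) \<Rightarrow> bool" where
  "Ck_in_charts M k A B F \<longleftrightarrow>
     (\<forall>c\<in>A. \<forall>c'\<in>B. Ck_map M k (pdim c) (pdim c')
        {x \<in> pdom c. F (pmap c x) \<in> pimg c'} (\<lambda>x. pinv c' (F (pmap c x))))"

text \<open>The last condition says that the transition maps are $C^k$.\<close>

definition finitary_manifold ::
  "('f, 'r, 'k::linordered_field) expansion \<Rightarrow> nat \<Rightarrow> nat \<Rightarrow> 'k list set \<Rightarrow> 'k list topology \<Rightarrow>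
   'k param set \<Rightarrow> bool" where
  "finitary_manifold M k n X \<tau> A \<longleftrightarrow>
     definable M n X \<and> topspace \<tau> = X \<and> finite A \<and>
     (\<exists>d. \<forall>c\<in>A. embedded_manifold M k (pdim c) d (pdom c)) \<and>
     (\<forall>c\<in>A. definable_map M (pdim c) n (pdom c) (pmap c) \<and> openin \<tau> (pimg c) \<and>
        homeomorphic_map (subtopology (Kn_top (pdim c)) (pdom c)) (subtopology \<tau> (pimg c)) (pmap c)) \<and>
     X = (\<Union>c\<in>A. pimg c) \<and>
     Ck_in_charts M k A A (\<lambda>x. x)"

definition prod_param :: "'k param \<Rightarrow> 'k param \<Rightarrow> 'k param" where
  "prod_param c c' =
     \<lparr>pdim = pdim c + pdim c',
      pdom = {x @ y | x y. x \<in> pdom c \<and> y \<in> pdom c'},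
      pmap = (\<lambda>z. pmap c (take (pdim c) z) @ pmap c' (drop (pdim c) z))\<rparr>"

definition prod_atlas :: "'k param set \<Rightarrow> 'k param set \<Rightarrow> 'k param set" where
  "prod_atlas A B = {prod_param c c' | c c'. c \<in> A \<and> c' \<in> B}"


section \<open>Definable groups\<close>

definition definable_group ::
  "('f, 'r, 'k::linordered_field) expansion \<Rightarrow> nat \<Rightarrow> ('k list, 'm) monoid_scheme \<Rightarrow> bool" where
  "definable_group M n G \<longleftrightarrow> group G \<and> definable M n (carrier G) \<and>
     definable M (3 * n) {x @ y @ (x \<otimes>\<^bsub>G\<^esub> y) | x y. x \<in> carrier G \<and> y \<in> carrier G}"

definition Ck_group_manifold ::
  "('f, 'r, 'k::linordered_field) expansion \<Rightarrow> nat \<Rightarrow> nat \<Rightarrow> ('k list, 'm) monoid_scheme \<Rightarrow>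
   'k list topology \<Rightarrow> 'k param set \<Rightarrow> bool" where
  "Ck_group_manifold M k n G \<tau> A \<longleftrightarrow>
     finitary_manifold M k n (carrier G) \<tau> A \<and>
     continuous_map (prod_topology \<tau> \<tau>) \<tau> (\<lambda>(x, y). x \<otimes>\<^bsub>G\<^esub> y) \<and>
     Ck_in_charts M k (prod_atlas A A) A (\<lambda>z. take n z \<otimes>\<^bsub>G\<^esub> drop n z) \<and>
     continuous_map \<tau> \<tau> (m_inv G) \<and>
     Ck_in_charts M k A A (m_inv G)"

definition is_group_manifold_topology ::
  "('f, 'r, 'k::linordered_field) expansion \<Rightarrow> nat \<Rightarrow> ('k list, 'm) monoid_scheme \<Rightarrow>
   'k list topology \<Rightarrow> bool" where
  "is_group_manifold_topology M n G \<tau> \<longleftrightarrow> (\<forall>k. \<exists>A. Ck_group_manifold M k n G \<tau> A)"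

text \<open>For a group definable in a d-minimal expansion of an ordered field there is exactly one
  group manifold topology, so the existential quantifier over \<open>\<tau>\<close> expresses ``in its group
  manifold topology''.\<close>

definition definably_connected_group ::
  "('f, 'r, 'k::linordered_field) expansion \<Rightarrow> nat \<Rightarrow> ('k list, 'm) monoid_scheme \<Rightarrow> bool" where
  "definably_connected_group M n G \<longleftrightarrow>
     (\<exists>\<tau>. is_group_manifold_topology M n G \<tau> \<and>
        (\<forall>S. definable M n S \<and> openin \<tau> S \<and> closedin \<tau> S \<longrightarrow> S = {} \<or> S = carrier G))"

definition divisible_group :: "('a, 'm) monoid_scheme \<Rightarrow> bool" where
  "divisible_group G \<longleftrightarrow>
     (\<forall>m::nat. m > 0 \<longrightarrow> (\<forall>x\<in>carrier G. \<exists>y\<in>carrier G. y [^]\<^bsub>G\<^esub> m = x))"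

end

(* The m-th power map p of the group is a homomorphism whose derivative at the identity is m times
   the identity, since the derivative of the multiplication at (1, 1) is (u, v) |-> u + v.  Hence p is
   locally surjective at the identity: in a chart, the point of a small closed ball whose image is
   nearest to a given target y exists by definable completeness, lies in the interior of the ball,
   and is mapped to y, as otherwise the distance could be decreased further.  So the image of p
   is a definable subgroup containing a neighbourhood of the identity, therefore clopen, and by
   definable connectedness it is the whole group. *)

theory Submission
  imports Defs
begin

section \<open>Definable predicates on environments\<close>

text \<open>The field may be non-Archimedean, so closed balls need not be compact, sequences need
  not detect closedness and a Newton iteration need not converge. What remains of completeness is
  the supremum of a definable subset of the line, so every set whose extremum is taken has to be cut
  out by a formula with parameters; a calculus of definable predicates therefore precedes the
  geometry. A nearest point in K^d is found by attaching the distance as a last coordinate and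
  projecting the other coordinates away one at a time. The l1 distance is convenient here: it is
  definable from addition, negation and order, without square roots, and its balls generate the box
  topology. The derivative, m times the identity, is invertible because m \<ge> 1 in an ordered
  field. Quantitatively, if q > 0 is the distance from p x to y, moving x by -t (p x - y) would gain
  t m q up to an error of t q / 2, which contradicts minimality.\<close>

primrec trm_rename :: "(nat \<Rightarrow> nat) \<Rightarrow> 'f trm \<Rightarrow> 'f trm" where
  "trm_rename r (Var i) = Var (r i)"
| "trm_rename r Zero = Zero"
| "trm_rename r One = One"
| "trm_rename r (Add s t) = Add (trm_rename r s) (trm_rename r t)"
| "trm_rename r (Minus t) = Minus (trm_rename r t)"
| "trm_rename r (Times s t) = Times (trm_rename r s) (trm_rename r t)"
| "trm_rename r (Fn f ts) = Fn f (map (trm_rename r) ts)"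

text \<open>The map \<open>r\<close> is arbitrary: it need not be injective, so renaming can also
  identify variables. Below a quantifier, index 0 is the bound variable and stays fixed.\<close>

primrec form_rename :: "(nat \<Rightarrow> nat) \<Rightarrow> ('f, 'r) form \<Rightarrow> ('f, 'r) form" where
  "form_rename r (Eq s t) = Eq (trm_rename r s) (trm_rename r t)"
| "form_rename r (Less s t) = Less (trm_rename r s) (trm_rename r t)"
| "form_rename r (Rel R ts) = Rel R (map (trm_rename r) ts)"
| "form_rename r (Neg \<phi>) = Neg (form_rename r \<phi>)"
| "form_rename r (Conj \<phi> \<psi>) = Conj (form_rename r \<phi>) (form_rename r \<psi>)"
| "form_rename r (Exists \<phi>) = Exists (form_rename (case_nat 0 (\<lambda>i. Suc (r i))) \<phi>)"

lemma trm_val_rename: "trm_val M e (trm_rename r t) = trm_val M (\<lambda>i. e (r i)) t"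
proof (induction t)
  case (Fn f ts)
  then have "map (trm_val M e \<circ> trm_rename r) ts = map (trm_val M (\<lambda>i. e (r i))) ts"
    by simp
  then show ?case by (simp only: trm_rename.simps trm_val.simps map_map)
qed simp_all

lemma sat_rename: "sat M e (form_rename r \<phi>) \<longleftrightarrow> sat M (\<lambda>i. e (r i)) \<phi>"
proof (induction \<phi> arbitrary: e r)
  case (Exists \<phi>)
  have "(\<lambda>i. case_nat a e (case_nat 0 (\<lambda>i. Suc (r i)) i)) = case_nat a (\<lambda>i. e (r i))" for a
    by (auto split: nat.split)
  then show ?case by (simp add: Exists.IH)
next
  case (Rel R ts)
  have "map (trm_val M e \<circ> trm_rename r) ts = map (trm_val M (\<lambda>i. e (r i))) ts"
    by (simp add: trm_val_rename)
  then show ?case by (simp only: form_rename.simps sat.simps map_map)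
qed (simp_all add: trm_val_rename)

definition atomic_term :: "((nat \<Rightarrow> 'k) \<Rightarrow> 'k) \<Rightarrow> bool" where
  "atomic_term t \<longleftrightarrow> (\<exists>k. t = (\<lambda>e. e k)) \<or> (\<exists>c. t = (\<lambda>e. c))"

text \<open>Each variable of the formula is bound either to a coordinate of the environment or to a
  parameter, so that substitutions and parameters are treated uniformly.\<close>

definition definable_pred ::
  "('f, 'r, 'k::linordered_field) expansion \<Rightarrow> ((nat \<Rightarrow> 'k) \<Rightarrow> bool) \<Rightarrow> bool" where
  "definable_pred M P \<longleftrightarrow>
     (\<exists>\<phi> t. (\<forall>i. atomic_term (t i)) \<and> (\<forall>e. P e \<longleftrightarrow> sat M (\<lambda>i. t i e) \<phi>))"

lemma atomic_term_coord [intro, simp]: "atomic_term (\<lambda>e. e k)"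
  by (auto simp: atomic_term_def)

lemma atomic_term_const [intro, simp]: "atomic_term (\<lambda>e. c)"
  by (auto simp: atomic_term_def)

lemma atomic_term_subst:
  assumes "atomic_term t" "\<And>i. atomic_term (s i)"
  shows "atomic_term (\<lambda>e. t (\<lambda>i. s i e))"
  using assms unfolding atomic_term_def[of t] by auto

lemma definable_pred_sat:
  "(\<And>i. atomic_term (t i)) \<Longrightarrow> definable_pred M (\<lambda>e. sat M (\<lambda>i. t i e) \<phi>)"
  unfolding definable_pred_def by blast

lemma definable_pred_subst:
  assumes "definable_pred M P" "\<And>i. atomic_term (s i)"
  shows "definable_pred M (\<lambda>e. P (\<lambda>i. s i e))"
proof -
  obtain \<phi> t where t: "\<And>i. atomic_term (t i)" "\<And>e. P e \<longleftrightarrow> sat M (\<lambda>i. t i e) \<phi>"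
    using assms(1) unfolding definable_pred_def by blast
  show ?thesis
    unfolding t(2) by (rule definable_pred_sat) (simp add: atomic_term_subst t(1) assms(2))
qed

lemma definable_pred_shift: "definable_pred M P \<Longrightarrow> definable_pred M (\<lambda>e. P (\<lambda>i. e (r i)))"
  by (rule definable_pred_subst) auto

lemma definable_pred_not: "definable_pred M P \<Longrightarrow> definable_pred M (\<lambda>e. \<not> P e)"
  unfolding definable_pred_def by (metis sat.simps(4))

lemma definable_pred_conj:
  assumes "definable_pred M P" "definable_pred M Q"
  shows "definable_pred M (\<lambda>e. P e \<and> Q e)"
proof -
  obtain \<phi> s where s: "\<And>i. atomic_term (s i)" "\<And>e. P e \<longleftrightarrow> sat M (\<lambda>i. s i e) \<phi>"
    using assms(1) unfolding definable_pred_def by blast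
  obtain \<psi> t where t: "\<And>i. atomic_term (t i)" "\<And>e. Q e \<longleftrightarrow> sat M (\<lambda>i. t i e) \<psi>"
    using assms(2) unfolding definable_pred_def by blast
  \<comment> \<open>The two formulas bind the same variable indices to different things. Even
    indices carry the variables of the first formula and odd ones those of the second, so one
    assignment serves both.\<close>
  define u where "u i = (if even i then s (i div 2) else t (i div 2))" for i
  have "P e \<and> Q e \<longleftrightarrow>
      sat M (\<lambda>i. u i e) (Conj (form_rename (\<lambda>i. 2 * i) \<phi>) (form_rename (\<lambda>i. 2 * i + 1) \<psi>))" for e
    by (simp add: sat_rename u_def s t)
  moreover have "atomic_term (u i)" for i by (simp add: u_def s t)
  ultimately show ?thesis unfolding definable_pred_def by blast
qed

lemma definable_pred_disj:
  "definable_pred M P \<Longrightarrow> definable_pred M Q \<Longrightarrow> definable_pred M (\<lambda>e. P e \<or> Q e)"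
  using definable_pred_not[OF definable_pred_conj[OF definable_pred_not definable_pred_not]]
  by fastforce

lemma definable_pred_imp:
  "definable_pred M P \<Longrightarrow> definable_pred M Q \<Longrightarrow> definable_pred M (\<lambda>e. P e \<longrightarrow> Q e)"
  unfolding imp_conv_disj by (intro definable_pred_disj definable_pred_not)

text \<open>In the hypothesis the quantified element sits in entry 0 and the old environment is
  shifted by one, as below a de Bruijn binder. Several variables of the formula may read entry 0;
  all of them are renamed to the bound variable.\<close>

lemma definable_pred_ex:
  assumes "definable_pred M (\<lambda>e. P (\<lambda>i. e (Suc i)) (e 0))"
  shows "definable_pred M (\<lambda>e. \<exists>a. P e a)"
proof -
  obtain \<phi> t where t: "\<And>i. atomic_term (t i)"
      "\<And>e. P (\<lambda>i. e (Suc i)) (e 0) \<longleftrightarrow> sat M (\<lambda>i. t i e) \<phi>"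
    using assms unfolding definable_pred_def by blast
  have P: "P e a \<longleftrightarrow> sat M (\<lambda>i. t i (case_nat a e)) \<phi>" for e a
    using t(2)[of "case_nat a e"] by simp
  have "\<exists>b s. atomic_term s \<and> (\<forall>a e. t i (case_nat a e) = (if b then a else s e))" for i
  proof -
    consider "t i = (\<lambda>e. e 0)" | k where "t i = (\<lambda>e. e (Suc k))" | c where "t i = (\<lambda>e. c)"
      using t(1)[of i] unfolding atomic_term_def by (metis not0_implies_Suc)
    then show ?thesis
    proof cases
      case 1
      \<comment> \<open>The constant 0 is a placeholder, since for \<open>b = True\<close> the value
        of \<open>s\<close> is never read.\<close>
      then show ?thesis by (intro exI[of _ True] exI[of _ "\<lambda>e. 0"]) auto
    next
      case (2 k)
      then show ?thesis by (intro exI[of _ False] exI[of _ "\<lambda>e. e k"]) auto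
    next
      case (3 c)
      then show ?thesis by (intro exI[of _ False] exI[of _ "\<lambda>e. c"]) auto
    qed
  qed
  then obtain b s where s: "\<And>i. atomic_term (s i)"
      "\<And>i a e. t i (case_nat a e) = (if b i then a else s i e)"
    by metis
  define r where "r i = (if b i then 0 else Suc i)" for i
  have "(\<lambda>i. t i (case_nat a e)) = (\<lambda>i. case_nat a (\<lambda>i. s i e) (r i))" for a e
    by (auto simp: s r_def)
  then have "(\<exists>a. P e a) \<longleftrightarrow> sat M (\<lambda>i. s i e) (Exists (form_rename r \<phi>))" for e
    by (simp add: P sat_rename)
  then show ?thesis unfolding definable_pred_def using s(1) by blast
qed

text \<open>A quantifier over K^n is n element quantifiers. The innermost one binds the head of the
  list, so the list fills the entries 0, ..., n - 1 in order and the old environment begins at entry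
  n.\<close>

lemma definable_pred_ex_list:
  fixes M :: "('f, 'r, 'k::linordered_field) expansion"
  assumes "definable_pred M (\<lambda>e. P (\<lambda>i. e (i + n)) (map e [0..<n]))"
  shows "definable_pred M (\<lambda>e. \<exists>x\<in>Kn n. P e x)"
  using assms
proof (induction n arbitrary: P)
  case 0
  then show ?case by (simp add: Kn_def)
next
  case (Suc n)
  have "definable_pred M (\<lambda>e. \<exists>x\<in>Kn n. \<exists>a. P e (a # x))"
  proof (rule Suc.IH, rule definable_pred_ex)
    have "map e [0..<Suc n] = e 0 # map (\<lambda>i. e (Suc i)) [0..<n]" for e :: "nat \<Rightarrow> 'k"
      by (rule nth_equalityI) (auto simp: nth_Cons split: nat.split simp del: upt_Suc)
    then show "definable_pred M (\<lambda>e. P (\<lambda>i. e (Suc (i + n))) (e 0 # map (\<lambda>i. e (Suc i)) [0..<n]))"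
      using Suc.prems by simp
  qed
  moreover have "(\<exists>x\<in>Kn n. \<exists>a. P e (a # x)) \<longleftrightarrow> (\<exists>x\<in>Kn (Suc n). P e x)" for e
    by (auto simp: Kn_def length_Suc_conv)
  ultimately show ?case by simp
qed

lemma definable_pred_all_list:
  assumes "definable_pred M (\<lambda>e. P (\<lambda>i. e (i + n)) (map e [0..<n]))"
  shows "definable_pred M (\<lambda>e. \<forall>x\<in>Kn n. P e x)"
proof -
  have "definable_pred M (\<lambda>e. \<not> (\<exists>x\<in>Kn n. \<not> P e x))"
    by (rule definable_pred_not, rule definable_pred_ex_list, rule definable_pred_not, rule assms)
  then show ?thesis by simp
qed

lemma definable_pred_all_less:
  assumes "\<And>i. i < (n::nat) \<Longrightarrow> definable_pred M (P i)"
  shows "definable_pred M (\<lambda>e. \<forall>i<n. P i e)"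
  using assms
proof (induction n)
  case 0
  \<comment> \<open>The syntax has no truth constant; \<open>Neg (Less Zero Zero)\<close> is a
    formula that always holds.\<close>
  have "definable_pred M (\<lambda>e. sat M e (Neg (Less Zero Zero)))"
    using definable_pred_sat[of "\<lambda>i e. e i"] by blast
  then show ?case by simp
next
  case (Suc n)
  then have "definable_pred M (\<lambda>e. (\<forall>i<n. P i e) \<and> P n e)"
    by (intro definable_pred_conj) auto
  then show ?case by (simp add: All_less_Suc conj_commute)
qed

text \<open>Points of this kind can be substituted into a definable set by binding variables alone,
  without introducing quantifiers. The length is required in every environment so that coordinates
  are never read past the end.\<close>

definition atomic_list :: "nat \<Rightarrow> ((nat \<Rightarrow> 'k) \<Rightarrow> 'k list) \<Rightarrow> bool" where
  "atomic_list n f \<longleftrightarrow>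
     (\<forall>e. length (f e) = n) \<and> (\<forall>i<n. atomic_term (\<lambda>e. f e ! i))"

lemma atomic_list_coords: "length xs = n \<Longrightarrow> atomic_list n (\<lambda>e. map (\<lambda>i. e (r i)) xs)"
  by (auto simp: atomic_list_def)

lemma atomic_list_coords' [simp]: "length xs = n \<Longrightarrow> atomic_list n (\<lambda>e. map e xs)"
  by (auto simp: atomic_list_def)

lemma atomic_list_Cons:
  assumes "atomic_term s" "atomic_list n f"
  shows "atomic_list (Suc n) (\<lambda>e. s e # f e)"
proof -
  have "atomic_term (\<lambda>e. (s e # f e) ! i)" if "i < Suc n" for i
    using assms that by (cases i) (auto simp: atomic_list_def)
  then show ?thesis using assms by (simp add: atomic_list_def)
qed

lemma atomic_list_append:
  assumes "atomic_list m f" "atomic_list n g"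
  shows "atomic_list (m + n) (\<lambda>e. f e @ g e)"
proof -
  have "atomic_term (\<lambda>e. (f e @ g e) ! i)" if "i < m + n" for i
  proof (cases "i < m")
    case True
    then have "(\<lambda>e. (f e @ g e) ! i) = (\<lambda>e. f e ! i)"
      using assms by (simp add: atomic_list_def nth_append)
    then show ?thesis using assms True by (simp add: atomic_list_def)
  next
    case False
    then have "(\<lambda>e. (f e @ g e) ! i) = (\<lambda>e. g e ! (i - m))"
      using assms by (simp add: atomic_list_def nth_append)
    then show ?thesis using assms False that by (simp add: atomic_list_def)
  qed
  then show ?thesis using assms by (simp add: atomic_list_def)
qed

lemma atomic_list_shift: "atomic_list n f \<Longrightarrow> atomic_list n (\<lambda>e. f (\<lambda>i. e (r i)))"
  unfolding atomic_list_def
  using atomic_term_subst[of "\<lambda>e. f e ! i" "\<lambda>i e. e (r i)" for i] by simp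

lemma definable_pred_mem:
  assumes "definable M n X" "atomic_list n f"
  shows "definable_pred M (\<lambda>e. f e \<in> X)"
proof -
  obtain \<phi> p where X: "X = def_set M n \<phi> p" using assms(1) unfolding definable_def by blast
  define t where "t i = (if i < n then (\<lambda>e. f e ! i) else (\<lambda>e. p (i - n)))" for i
  have "f e \<in> X \<longleftrightarrow> sat M (\<lambda>i. t i e) \<phi>" for e
  proof -
    have "length (f e) = n" using assms(2) by (simp add: atomic_list_def)
    moreover from this have "assign (f e) p = (\<lambda>i. t i e)"
      by (auto simp: assign_def t_def)
    ultimately show ?thesis by (simp add: X def_set_def Kn_def)
  qed
  moreover have "atomic_term (t i)" for i
    using assms(2) by (auto simp: t_def atomic_list_def)
  ultimately show ?thesis unfolding definable_pred_def by blast
qed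

text \<open>The way back from environments to formulas with parameters. The predicate may read
  entries beyond n; after padding the point by zeros such entries are constants and become
  parameters.\<close>

lemma definable_if_definable_pred:
  fixes M :: "('f, 'r, 'k::linordered_field) expansion"
  assumes "definable_pred M (\<lambda>e. map e [0..<n] \<in> X)" "X \<subseteq> Kn n"
  shows "definable M n X"
proof -
  obtain \<phi> t where t: "\<And>i. atomic_term (t i)" "\<And>e. map e [0..<n] \<in> X \<longleftrightarrow> sat M (\<lambda>i. t i e) \<phi>"
    using assms unfolding definable_pred_def by blast
  define ext where "ext x = assign x (\<lambda>_. 0::'k)" for x
  have "\<exists>k c. \<forall>x\<in>Kn n. t i (ext x) = (if k < n then x ! k else c)" for i
  proof -
    consider k where "t i = (\<lambda>e. e k)" | c where "t i = (\<lambda>e. c)"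
      using t(1)[of i] unfolding atomic_term_def by blast
    then show ?thesis
    proof cases
      case (1 k)
      then show ?thesis
        by (intro exI[of _ k] exI[of _ 0]) (auto simp: ext_def assign_def Kn_def)
    next
      case (2 c)
      then show ?thesis by (intro exI[of _ n] exI[of _ c]) auto
    qed
  qed
  then obtain k c where kc:
      "\<And>i x. x \<in> Kn n \<Longrightarrow> t i (ext x) = (if k i < n then x ! k i else c i)"
    by metis
  \<comment> \<open>Each variable \<open>i\<close> that does not read a coordinate gets a parameter
    slot of its own, \<open>n + i\<close>, which holds \<open>c i\<close>.\<close>
  define r where "r i = (if k i < n then k i else n + i)" for i
  have "x \<in> X \<longleftrightarrow> sat M (assign x c) (form_rename r \<phi>)" if x: "x \<in> Kn n" for x
  proof -
    have "map (ext x) [0..<n] = x"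
      using x by (intro nth_equalityI) (auto simp: ext_def assign_def Kn_def)
    then have "x \<in> X \<longleftrightarrow> sat M (\<lambda>i. t i (ext x)) \<phi>" using t(2)[of "ext x"] by simp
    moreover have "(\<lambda>i. t i (ext x)) = (\<lambda>i. assign x c (r i))"
      using x by (auto simp: kc r_def assign_def Kn_def)
    ultimately show ?thesis by (simp add: sat_rename)
  qed
  then have "X = def_set M n (form_rename r \<phi>) c"
    using assms(2) by (auto simp: def_set_def)
  then show ?thesis unfolding definable_def by blast
qed

section \<open>Definable functions of the environment\<close>

definition definable_fun ::
  "('f, 'r, 'k::linordered_field) expansion \<Rightarrow> ((nat \<Rightarrow> 'k) \<Rightarrow> 'k) \<Rightarrow> bool" where
  "definable_fun M s \<longleftrightarrow> definable_pred M (\<lambda>e. e 0 = s (\<lambda>i. e (Suc i)))"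

lemma definable_pred_atomic_eq:
  assumes "atomic_term s" "atomic_term t"
  shows "definable_pred M (\<lambda>e. s e = t e)"
  using definable_pred_sat[of "\<lambda>i. if i = 0 then s else t" M "Eq (Var 0) (Var 1)"] assms by simp

lemma definable_pred_atomic_less:
  assumes "atomic_term s" "atomic_term t"
  shows "definable_pred M (\<lambda>e. s e < t e)"
  using definable_pred_sat[of "\<lambda>i. if i = 0 then s else t" M "Less (Var 0) (Var 1)"] assms by simp

lemma definable_fun_atomic: "atomic_term s \<Longrightarrow> definable_fun M s"
  unfolding definable_fun_def
  using atomic_term_subst[of s "\<lambda>i e. e (Suc i)"] by (intro definable_pred_atomic_eq) simp_all

lemma definable_fun_shift: 
  "definable_fun M s \<Longrightarrow> definable_fun M (\<lambda>e. s (\<lambda>i. e (r i)))"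
  unfolding definable_fun_def
  by (drule definable_pred_shift[where r = "case_nat 0 (\<lambda>i. Suc (r i))"]) simp

text \<open>A non-atomic term is substituted by quantifying over its value: \<open>P (s e) e\<close>
  is rewritten as \<open>\<exists>a. a = s e \<and> P a e\<close>.\<close>

lemma definable_pred_fun_subst:
  assumes P: "definable_pred M (\<lambda>e. P (e 0) (\<lambda>i. e (Suc i)))" and s: "definable_fun M s"
  shows "definable_pred M (\<lambda>e. P (s e) e)"
proof -
  have "definable_pred M (\<lambda>e. \<exists>a. a = s e \<and> P a e)"
    using P s unfolding definable_fun_def
    by (intro definable_pred_ex definable_pred_conj)
  then show ?thesis by simp
qed

lemma definable_pred_fun_subst2:
  assumes R: "definable_pred M (\<lambda>e. R (e 0) (e 1))" and s: "definable_fun M s" "definable_fun M t"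
  shows "definable_pred M (\<lambda>e. R (s e) (t e))"
proof (rule definable_pred_fun_subst[OF _ s(1)])
  show "definable_pred M (\<lambda>e. R (e 0) (t (\<lambda>i. e (Suc i))))"
  proof (rule definable_pred_fun_subst[OF _ definable_fun_shift[OF s(2)]])
    show "definable_pred M (\<lambda>e. R (e (Suc 0)) (e 0))"
      \<comment> \<open>The map \<open>\<lambda>i. 1 - i\<close> swaps the entries 0 and 1;
        truncated subtraction sends all others to 0, but \<open>R\<close> reads the first two
        entries only.\<close>
      using definable_pred_shift[OF R, of "\<lambda>i. 1 - i"] by simp
  qed
qed

lemma definable_pred_less:
  "definable_fun M s \<Longrightarrow> definable_fun M t \<Longrightarrow> definable_pred M (\<lambda>e. s e < t e)"
  by (rule definable_pred_fun_subst2[OF definable_pred_atomic_less]) auto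

lemma definable_pred_eq:
  "definable_fun M s \<Longrightarrow> definable_fun M t \<Longrightarrow> definable_pred M (\<lambda>e. s e = t e)"
  by (rule definable_pred_fun_subst2[OF definable_pred_atomic_eq]) auto

lemma definable_pred_le:
  "definable_fun M s \<Longrightarrow> definable_fun M t \<Longrightarrow> definable_pred M (\<lambda>e. s e \<le> t e)"
  unfolding not_less[symmetric] by (intro definable_pred_not definable_pred_less)

lemma definable_fun_add:
  assumes "definable_fun M s" "definable_fun M t"
  shows "definable_fun M (\<lambda>e. s e + t e)"
  unfolding definable_fun_def
proof (rule definable_pred_fun_subst[where P = "\<lambda>a e. e 0 = a + t (\<lambda>i. e (Suc i))",
    OF _ definable_fun_shift[OF assms(1)]])
  show "definable_pred M (\<lambda>e. e (Suc 0) = e 0 + t (\<lambda>i. e (Suc (Suc i))))"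
  proof (rule definable_pred_fun_subst[where P = "\<lambda>a e. e (Suc 0) = e 0 + a",
      OF _ definable_fun_shift[OF assms(2), of "\<lambda>i. Suc (Suc i)"]])
    show "definable_pred M (\<lambda>e. e (Suc (Suc 0)) = e (Suc 0) + e 0)"
      using definable_pred_sat[of "\<lambda>i e. e i" M "Eq (Var 2) (Add (Var 1) (Var 0))"]
      by (simp add: numeral_2_eq_2)
  qed
qed

lemma definable_fun_uminus:
  assumes "definable_fun M s"
  shows "definable_fun M (\<lambda>e. - s e)"
  unfolding definable_fun_def
proof (rule definable_pred_fun_subst[where P = "\<lambda>a e. e 0 = - a",
    OF _ definable_fun_shift[OF assms(1)]])
  show "definable_pred M (\<lambda>e. e (Suc 0) = - e 0)"
    using definable_pred_sat[of "\<lambda>i e. e i" M "Eq (Var 1) (Minus (Var 0))"] by simp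
qed

lemma definable_fun_diff:
  "definable_fun M s \<Longrightarrow> definable_fun M t \<Longrightarrow> definable_fun M (\<lambda>e. s e - t e)"
  using definable_fun_add[OF _ definable_fun_uminus, of M s t] by simp

lemma definable_fun_abs:
  assumes "definable_fun M s"
  shows "definable_fun M (\<lambda>e. \<bar>s e\<bar>)"
proof -
  have "definable_pred M (\<lambda>e. (0 \<le> s (\<lambda>i. e (Suc i)) \<and> e 0 = s (\<lambda>i. e (Suc i))) \<or>
      (s (\<lambda>i. e (Suc i)) < 0 \<and> e 0 = - s (\<lambda>i. e (Suc i))))"
    by (intro definable_pred_disj definable_pred_conj definable_pred_le definable_pred_less
        definable_pred_eq definable_fun_uminus definable_fun_shift[OF assms] definable_fun_atomic) auto
  moreover have "((0 \<le> s (\<lambda>i. e (Suc i)) \<and> e 0 = s (\<lambda>i. e (Suc i))) \<or>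
      (s (\<lambda>i. e (Suc i)) < 0 \<and> e 0 = - s (\<lambda>i. e (Suc i)))) \<longleftrightarrow> e 0 = \<bar>s (\<lambda>i. e (Suc i))\<bar>" for e
    by (auto simp: abs_if)
  ultimately show ?thesis unfolding definable_fun_def by simp
qed

lemma definable_fun_sum:
  assumes "\<And>i. i < (n::nat) \<Longrightarrow> definable_fun M (s i)"
  shows "definable_fun M (\<lambda>e. \<Sum>i<n. s i e)"
  using assms
proof (induction n)
  case (Suc n)
  then show ?case by (simp add: definable_fun_add)
qed (simp add: definable_fun_atomic)

lemma definable_fun_l1_dist:
  assumes "\<And>i. i < n \<Longrightarrow> definable_fun M (\<lambda>e. f e ! i)" "\<And>i. i < n \<Longrightarrow> definable_fun M (\<lambda>e. g e ! i)"
  shows "definable_fun M (\<lambda>e. l1_dist n (f e) (g e))"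
  unfolding l1_dist_def using assms
  by (intro definable_fun_sum definable_fun_abs definable_fun_diff) auto

lemmas definable_pred_intros = definable_pred_not definable_pred_conj definable_pred_disj
  definable_pred_imp definable_pred_less definable_pred_le definable_pred_eq

lemma definable_complete_sup:
  assumes "definably_complete M" "definable_pred M (\<lambda>e. P (e 0))"
    and "P b" "\<And>a. P a \<Longrightarrow> a \<le> c"
  obtains s where "\<And>a. P a \<Longrightarrow> a \<le> s" "\<And>u. (\<And>a. P a \<Longrightarrow> a \<le> u) \<Longrightarrow> s \<le> u"
proof -
  define X where "X = {[a] | a. P a}"
  have "definable M 1 X"
    unfolding X_def by (rule definable_if_definable_pred) (use assms(2) in \<open>auto simp: Kn_def\<close>)
  moreover have X: "{a. [a] \<in> X} = Collect P" by (auto simp: X_def)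
  moreover have "bdd_above (Collect P)" using assms(4) unfolding bdd_above_def by blast
  moreover have "Collect P \<noteq> {}" using assms(3) by blast
  ultimately have "\<exists>s. (\<forall>a\<in>Collect P. a \<le> s) \<and> (\<forall>u. (\<forall>a\<in>Collect P. a \<le> u) \<longrightarrow> s \<le> u)"
    using assms(1)[unfolded definably_complete_def Let_def, rule_format, of X] unfolding X by blast
  then show thesis using that by auto
qed

section \<open>The topology of $K^n$\<close>

lemma l1_dist_nonneg [simp]: "0 \<le> l1_dist n x y"
  by (simp add: l1_dist_def sum_nonneg)

lemma l1_dist_self [simp]: "l1_dist n x x = 0"
  by (simp add: l1_dist_def)

lemma l1_dist_commute: "l1_dist n x y = l1_dist n y x"
  by (simp add: l1_dist_def abs_minus_commute)

lemma l1_dist_triangle: "l1_dist n x z \<le> l1_dist n x y + l1_dist n y z"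
  unfolding l1_dist_def sum.distrib[symmetric]
  by (rule sum_mono) (metis abs_triangle_ineq diff_add_cancel add_diff_eq)

lemma abs_nth_le_l1_dist: "i < n \<Longrightarrow> \<bar>x ! i - y ! i\<bar> \<le> l1_dist n x y"
  unfolding l1_dist_def by (rule member_le_sum) auto

lemma l1_dist_eq_0D:
  assumes "x \<in> Kn n" "y \<in> Kn n" "l1_dist n x y = 0"
  shows "x = y"
proof (rule nth_equalityI)
  show "length x = length y" using assms by (simp add: Kn_def)
  show "x ! i = y ! i" if "i < length x" for i
    using abs_nth_le_l1_dist[of i n x y] assms that by (simp add: Kn_def)
qed

text \<open>The denominator n + 1 makes the final inequality strict and covers n = 0 as
  well.\<close>

lemma l1_dist_less:
  assumes "\<And>i. i < n \<Longrightarrow> \<bar>x ! i - y ! i\<bar> < \<rho> / of_nat (Suc n)" "(0::'k::linordered_field) < \<rho>"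
  shows "l1_dist n x y < \<rho>"
proof -
  have "l1_dist n x y \<le> of_nat n * (\<rho> / of_nat (Suc n))"
    unfolding l1_dist_def using sum_bounded_above[of "{..<n}"] assms(1)
    by (metis (no_types, lifting) card_lessThan lessThan_iff less_imp_le)
  also have "\<dots> < of_nat (Suc n) * (\<rho> / of_nat (Suc n))"
    using assms(2) by (intro mult_strict_right_mono divide_pos_pos)
      (simp_all only: of_nat_less_iff of_nat_0_less_iff lessI zero_less_Suc)
  also have "\<dots> = \<rho>" by (simp del: of_nat_Suc)
  finally show ?thesis .
qed

lemma ex_common_pos:
  fixes Q :: "nat \<Rightarrow> 'k::linordered_field \<Rightarrow> bool"
  assumes "\<And>i. i < n \<Longrightarrow> \<exists>r>0. Q i r" "\<And>i r s. Q i s \<Longrightarrow> 0 < r \<Longrightarrow> r \<le> s \<Longrightarrow> Q i r"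
  shows "\<exists>r>0. \<forall>i<n. Q i r"
  using assms(1)
proof (induction n)
  case 0
  show ?case by (intro exI[of _ 1]) simp
next
  case (Suc n)
  obtain r where r: "r > 0" "\<forall>i<n. Q i r" using Suc.IH Suc.prems less_SucI by blast
  obtain s where s: "s > 0" "Q n s" using Suc.prems by blast
  have "Q i (min r s)" if "i < Suc n" for i
    using assms(2)[of i r "min r s"] assms(2)[of i s "min r s"] r s that
    by (cases "i = n") auto
  moreover have "0 < min r s" using r s by simp
  ultimately show ?case by blast
qed

lemma open_interval_nbhd:
  fixes a :: "'k::linordered_field"
  assumes "open_interval I" "a \<in> I"
  shows "\<exists>r>0. \<forall>b. \<bar>b - a\<bar> < r \<longrightarrow> b \<in> I"
proof -
  consider c d where "I = {c<..<d}" | c where "I = {c<..}" | c where "I = {..<c}" | "I = UNIV"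
    using assms(1) unfolding open_interval_def by blast
  then show ?thesis
  proof cases
    case 1
    with assms(2) show ?thesis by (intro exI[of _ "min (a - c) (d - a)"]) auto
  next
    case 2
    with assms(2) show ?thesis by (intro exI[of _ "a - c"]) auto
  next
    case 3
    with assms(2) show ?thesis by (intro exI[of _ "c - a"]) auto
  next
    case 4
    then show ?thesis by (intro exI[of _ 1]) auto
  qed
qed

lemma open_box_nbhd:
  assumes "open_box n B" "a \<in> B"
  shows "\<exists>\<rho>>0. \<forall>x\<in>Kn n. l1_dist n x a < \<rho> \<longrightarrow> x \<in> B"
proof -
  obtain I where I: "\<And>i. i < n \<Longrightarrow> open_interval (I i)" "B = {x \<in> Kn n. \<forall>i<n. x ! i \<in> I i}"
    using assms(1) unfolding open_box_def by blast
  have "\<exists>\<rho>>0. \<forall>i<n. \<forall>b. \<bar>b - a ! i\<bar> < \<rho> \<longrightarrow> b \<in> I i"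
  proof (rule ex_common_pos)
    show "\<exists>\<rho>>0. \<forall>b. \<bar>b - a ! i\<bar> < \<rho> \<longrightarrow> b \<in> I i" if "i < n" for i
      using assms(2) that unfolding I(2) by (intro open_interval_nbhd I(1)) auto
  qed auto
  then obtain \<rho> where \<rho>: "\<rho> > 0" "\<And>i b. i < n \<Longrightarrow> \<bar>b - a ! i\<bar> < \<rho> \<Longrightarrow> b \<in> I i" by blast
  have "x \<in> B" if "x \<in> Kn n" "l1_dist n x a < \<rho>" for x
  proof -
    have "x ! i \<in> I i" if "i < n" for i
      using \<rho>(2)[OF that, of "x ! i"] abs_nth_le_l1_dist[OF that, of x a] \<open>l1_dist n x a < \<rho>\<close>
      by linarith
    with that show ?thesis unfolding I(2) by blast
  qed
  with \<rho>(1) show ?thesis by (intro exI[of _ \<rho>]) simp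
qed

lemma open_box_subset_Kn: "open_box n B \<Longrightarrow> B \<subseteq> Kn n"
  by (auto simp: open_box_def)

lemma openin_Kn_top_open_box: "open_box n B \<Longrightarrow> openin (Kn_top n) B"
  unfolding Kn_top_def by (rule topology_generated_by_Basis) simp

text \<open>Boxes and l1 balls generate the same topology: a box contains a ball because every
  coordinate difference is at most the distance, and a ball of radius \<rho> contains the box of
  half-width \<rho> / (n + 1).\<close>

lemma openin_Kn_top_iff:
  "openin (Kn_top n) (U :: 'k::linordered_field list set) \<longleftrightarrow>
     U \<subseteq> Kn n \<and> (\<forall>a\<in>U. \<exists>\<rho>>0. \<forall>x\<in>Kn n. l1_dist n x a < \<rho> \<longrightarrow> x \<in> U)"
proof
  assume "openin (Kn_top n) U"
  then have "generate_topology_on {B. open_box n B} U"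
    by (simp add: Kn_top_def openin_topology_generated_by_iff)
  then show "U \<subseteq> Kn n \<and> (\<forall>a\<in>U. \<exists>\<rho>>0. \<forall>x\<in>Kn n. l1_dist n x a < \<rho> \<longrightarrow> x \<in> U)"
  proof induction
    case (Int S T)
    have "\<exists>\<rho>>0. \<forall>x\<in>Kn n. l1_dist n x a < \<rho> \<longrightarrow> x \<in> S \<inter> T" if "a \<in> S \<inter> T" for a
    proof -
      obtain \<rho> where "\<rho> > 0" "\<forall>x\<in>Kn n. l1_dist n x a < \<rho> \<longrightarrow> x \<in> S"
        using Int.IH(1) \<open>a \<in> S \<inter> T\<close> by (meson IntD1)
      moreover obtain \<rho>' where "\<rho>' > 0" "\<forall>x\<in>Kn n. l1_dist n x a < \<rho>' \<longrightarrow> x \<in> T"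
        using Int.IH(2) \<open>a \<in> S \<inter> T\<close> by (meson IntD2)
      ultimately show ?thesis by (intro exI[of _ "min \<rho> \<rho>'"]) auto
    qed
    with Int.IH show ?case by blast
  next
    case (UN K)
    then show ?case by (fastforce intro: Union_least)
  next
    case (Basis s)
    then show ?case using open_box_nbhd open_box_subset_Kn by blast
  qed simp
next
  assume U: "U \<subseteq> Kn n \<and> (\<forall>a\<in>U. \<exists>\<rho>>0. \<forall>x\<in>Kn n. l1_dist n x a < \<rho> \<longrightarrow> x \<in> U)"
  show "openin (Kn_top n) U"
  proof (subst openin_subopen, rule ballI)
    fix a assume a: "a \<in> U"
    obtain \<rho> where \<rho>: "\<rho> > 0" "\<And>x. x \<in> Kn n \<Longrightarrow> l1_dist n x a < \<rho> \<Longrightarrow> x \<in> U"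
      using U a by blast
    define r where "r = \<rho> / of_nat (Suc n)"
    have r: "r > 0" using \<rho>(1) by (simp add: r_def del: of_nat_Suc)
    define B where "B = {x \<in> Kn n. \<forall>i<n. x ! i \<in> {a ! i - r<..<a ! i + r}}"
    have "open_box n B"
      unfolding open_box_def B_def
      by (intro exI[of _ "\<lambda>i. {a ! i - r<..<a ! i + r}"]) (auto simp: open_interval_def)
    moreover have "a \<in> B" using a U r by (auto simp: B_def)
    moreover have "B \<subseteq> U"
    proof
      fix x assume x: "x \<in> B"
      then have "\<bar>x ! i - a ! i\<bar> < \<rho> / of_nat (Suc n)" if "i < n" for i
        using that unfolding r_def[symmetric] B_def by (auto simp: abs_less_iff)
      then show "x \<in> U" using x \<rho> l1_dist_less unfolding B_def by blast
    qed
    ultimately show "\<exists>T. openin (Kn_top n) T \<and> a \<in> T \<and> T \<subseteq> U"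
      using openin_Kn_top_open_box by blast
  qed
qed

lemma topspace_Kn_top [simp]: "topspace (Kn_top n :: 'k::linordered_field list topology) = Kn n"
proof -
  have "openin (Kn_top n) (Kn n :: 'k list set)"
    unfolding openin_Kn_top_iff by (auto intro: exI[of _ 1])
  then show ?thesis
    using openin_Kn_top_iff[of n "topspace (Kn_top n)"] openin_subset by blast
qed

section \<open>Neighbourhood filters and limits\<close>

abbreviation nhds_Kn :: "nat \<Rightarrow> 'k::linordered_field list \<Rightarrow> 'k list filter" where
  "nhds_Kn n a \<equiv> nhdsin (Kn_top n) a"

lemma eventually_nhds_Kn:
  assumes "a \<in> Kn n"
  shows "eventually P (nhds_Kn n a) \<longleftrightarrow> (\<exists>\<rho>>0. \<forall>x\<in>Kn n. l1_dist n x a < \<rho> \<longrightarrow> P x)"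
proof
  assume "eventually P (nhds_Kn n a)"
  then obtain S where "openin (Kn_top n) S" "a \<in> S" "\<forall>x\<in>S. P x"
    using assms unfolding eventually_nhdsin by auto
  then show "\<exists>\<rho>>0. \<forall>x\<in>Kn n. l1_dist n x a < \<rho> \<longrightarrow> P x"
    unfolding openin_Kn_top_iff by blast
next
  assume "\<exists>\<rho>>0. \<forall>x\<in>Kn n. l1_dist n x a < \<rho> \<longrightarrow> P x"
  then obtain \<rho> where \<rho>: "\<rho> > 0" "\<forall>x\<in>Kn n. l1_dist n x a < \<rho> \<longrightarrow> P x" by blast
  have "\<exists>r>0. \<forall>x\<in>Kn n. l1_dist n x b < r \<longrightarrow> l1_dist n x a < \<rho>" if "l1_dist n b a < \<rho>" for b
  proof (intro exI[of _ "\<rho> - l1_dist n b a"] conjI ballI impI)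
    show "l1_dist n x a < \<rho>" if "l1_dist n x b < \<rho> - l1_dist n b a" for x
      using l1_dist_triangle[of n x a b] that by linarith
  qed (use that in simp)
  then have "openin (Kn_top n) {x \<in> Kn n. l1_dist n x a < \<rho>}"
    unfolding openin_Kn_top_iff by auto
  then show "eventually P (nhds_Kn n a)"
    unfolding eventually_nhdsin using \<rho> assms
    by (intro disjI2 exI[of _ "{x \<in> Kn n. l1_dist n x a < \<rho>}"]) auto
qed

text \<open>An open set that witnesses the property at \<open>a\<close> witnesses it at each of its
  points. This handles the nested neighbourhoods in the definition of strict gradients.\<close>

lemma eventually_eventually_nhdsin:
  "eventually P (nhdsin X a) \<Longrightarrow> eventually (\<lambda>x. eventually P (nhdsin X x)) (nhdsin X a)"
  unfolding eventually_nhdsin by blast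

lemma eventually_nhdsin_self: "eventually P (nhdsin X a) \<Longrightarrow> a \<in> topspace X \<Longrightarrow> P a"
  unfolding eventually_nhdsin by blast

lemma eventually_in_openin: "openin X S \<Longrightarrow> a \<in> S \<Longrightarrow> eventually (\<lambda>x. x \<in> S) (nhdsin X a)"
  unfolding eventually_nhdsin by blast

lemma eventually_in_topspace: "eventually (\<lambda>x. x \<in> topspace X) (nhdsin X a)"
  unfolding eventually_nhdsin by blast

lemma eventually_in_Kn:
  "eventually (\<lambda>x. x \<in> Kn n) (nhds_Kn n (a :: 'k::linordered_field list))"
  using eventually_in_topspace[of "Kn_top n" a] by simp

lemma nhdsin_open_subtopology:
  assumes "openin X U" "a \<in> U"
  shows "nhdsin (subtopology X U) a = nhdsin X a"
  unfolding filter_eq_iff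
proof (intro allI iffI)
  fix P
  have a: "a \<in> topspace X" using openin_subset[OF assms(1)] assms(2) by blast
  show "eventually P (nhdsin X a)" if "eventually P (nhdsin (subtopology X U) a)"
    using that assms a by (auto simp: eventually_nhdsin openin_open_subtopology)
  show "eventually P (nhdsin (subtopology X U) a)" if ev: "eventually P (nhdsin X a)"
  proof -
    obtain S where "openin X S" "a \<in> S" "\<forall>x\<in>S. P x"
      using ev a by (auto simp: eventually_nhdsin)
    then show ?thesis
      using assms unfolding eventually_nhdsin openin_open_subtopology[OF assms(1)]
      by (intro disjI2 exI[of _ "S \<inter> U"]) auto
  qed
qed

lemma openin_eventually:
  assumes "S \<subseteq> topspace X" "\<And>a. a \<in> S \<Longrightarrow> eventually (\<lambda>x. x \<in> S) (nhdsin X a)"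
  shows "openin X S"
proof (subst openin_subopen, rule ballI)
  fix a assume "a \<in> S"
  then show "\<exists>T. openin X T \<and> a \<in> T \<and> T \<subseteq> S"
    using assms(1) assms(2)[of a] unfolding eventually_nhdsin by (auto simp: subset_eq)
qed

lemma continuous_map_imp_filterlim_nhdsin:
  assumes "continuous_map X Y f" "a \<in> topspace X"
  shows "filterlim f (nhdsin Y (f a)) (nhdsin X a)"
  unfolding filterlim_iff
proof (intro allI impI)
  fix P assume "eventually P (nhdsin Y (f a))"
  moreover have "f a \<in> topspace Y"
    using assms continuous_map_image_subset_topspace by blast
  ultimately obtain S where S: "openin Y S" "f a \<in> S" "\<forall>y\<in>S. P y"
    unfolding eventually_nhdsin by blast
  then have "openin X {x \<in> topspace X. f x \<in> S}"
    using assms openin_continuous_map_preimage by blast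
  then show "eventually (\<lambda>x. P (f x)) (nhdsin X a)"
    unfolding eventually_nhdsin using S assms by (intro disjI2 exI) auto
qed

lemma filterlim_eventually_in_openin:
  assumes "filterlim f (nhdsin X a) F" "openin X S" "a \<in> S"
  shows "\<forall>\<^sub>F x in F. f x \<in> S"
  using assms(1)[unfolded filterlim_iff, rule_format, OF eventually_in_openin[OF assms(2,3)]] .

lemma filterlim_nhdsin_subtopology:
  assumes "filterlim f (nhdsin X a) F" "\<forall>\<^sub>F x in F. f x \<in> S" "a \<in> topspace X" "a \<in> S"
  shows "filterlim f (nhdsin (subtopology X S) a) F"
  unfolding filterlim_iff
proof (intro allI impI)
  fix P assume "eventually P (nhdsin (subtopology X S) a)"
  then obtain T where T: "openin X T" "a \<in> T" "\<forall>x\<in>T \<inter> S. P x"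
    using assms(3,4) unfolding eventually_nhdsin openin_subtopology by auto
  have "\<forall>\<^sub>F x in F. f x \<in> T"
    by (rule filterlim_eventually_in_openin[OF assms(1) T(1,2)])
  with assms(2) show "\<forall>\<^sub>F x in F. P (f x)"
    by eventually_elim (use T(3) in blast)
qed

lemma filterlim_Pair_nhdsin:
  assumes "filterlim f (nhdsin X a) F" "filterlim g (nhdsin Y b) F" "a \<in> topspace X" "b \<in> topspace Y"
  shows "filterlim (\<lambda>x. (f x, g x)) (nhdsin (prod_topology X Y) (a, b)) F"
  unfolding filterlim_iff
proof (intro allI impI)
  fix P assume "eventually P (nhdsin (prod_topology X Y) (a, b))"
  then obtain W where W: "openin (prod_topology X Y) W" "(a, b) \<in> W" "\<forall>z\<in>W. P z"
    using assms(3,4) by (auto simp: eventually_nhdsin)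
  then obtain S T where ST: "openin X S" "openin Y T" "a \<in> S" "b \<in> T" "S \<times> T \<subseteq> W"
    using W(1)[unfolded openin_prod_topology_alt, rule_format, OF W(2)] by blast
  have "\<forall>\<^sub>F x in F. f x \<in> S"
    by (rule filterlim_eventually_in_openin[OF assms(1) ST(1,3)])
  moreover have "\<forall>\<^sub>F x in F. g x \<in> T"
    by (rule filterlim_eventually_in_openin[OF assms(2) ST(2,4)])
  ultimately show "\<forall>\<^sub>F x in F. P (f x, g x)"
  proof eventually_elim
    case (elim x)
    then have "(f x, g x) \<in> W" using ST(5) by blast
    then show ?case using W(3) by blast
  qed
qed

lemma eventually_l1_dist_less:
  assumes "a \<in> Kn n" "0 < \<epsilon>"
  shows "eventually (\<lambda>x. l1_dist n x a < \<epsilon>) (nhds_Kn n a)"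
  using assms by (auto simp: eventually_nhds_Kn)

lemma filterlim_nhds_Kn:
  assumes "b \<in> Kn m" "eventually (\<lambda>x. u x \<in> Kn m) F"
    and "\<And>\<epsilon>. 0 < \<epsilon> \<Longrightarrow> eventually (\<lambda>x. l1_dist m (u x) b < \<epsilon>) F"
  shows "filterlim u (nhds_Kn m b) F"
  unfolding filterlim_iff
proof (intro allI impI)
  fix P assume "eventually P (nhds_Kn m b)"
  then obtain \<rho> where \<rho>: "\<rho> > 0" "\<And>x. x \<in> Kn m \<Longrightarrow> l1_dist m x b < \<rho> \<Longrightarrow> P x"
    using assms(1) by (auto simp: eventually_nhds_Kn)
  show "eventually (\<lambda>x. P (u x)) F"
    using assms(2) assms(3)[OF \<rho>(1)] by eventually_elim (rule \<rho>(2))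
qed

section \<open>Closed bounded definable sets\<close>

lemma closedin_Kn_top_iff:
  "closedin (Kn_top n) (C :: 'k::linordered_field list set) \<longleftrightarrow>
     C \<subseteq> Kn n \<and> (\<forall>a\<in>Kn n. (\<forall>\<epsilon>>0. \<exists>x\<in>C. l1_dist n x a < \<epsilon>) \<longrightarrow> a \<in> C)"
proof -
  have "openin (Kn_top n) (Kn n - C) \<longleftrightarrow>
      (\<forall>a\<in>Kn n - C. \<exists>\<epsilon>>0. \<forall>x\<in>Kn n. l1_dist n x a < \<epsilon> \<longrightarrow> x \<notin> C)"
    unfolding openin_Kn_top_iff by auto
  then show ?thesis unfolding closedin_def topspace_Kn_top by (auto simp: subset_iff) (metis | blast)+
qed

lemma l1_dist_Cons: "l1_dist (Suc n) (a # x) (b # y) = \<bar>a - b\<bar> + l1_dist n x y"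
  by (simp add: l1_dist_def sum.lessThan_Suc_shift del: sum.lessThan_Suc)

lemma Kn_SucE:
  assumes "x \<in> Kn (Suc n)"
  obtains a y where "x = a # y" "y \<in> Kn n"
  using assms by (auto simp: Kn_def length_Suc_conv)

lemma definable_drop_first:
  assumes "definable M (Suc n) C"
  shows "definable M n {x \<in> Kn n. \<exists>a. a # x \<in> C}"
proof (rule definable_if_definable_pred)
  have "definable_pred M (\<lambda>e. \<exists>a. a # map e [0..<n] \<in> C)"
    by (intro definable_pred_ex definable_pred_mem[OF assms] atomic_list_Cons atomic_list_coords) auto
  then show "definable_pred M (\<lambda>e. map e [0..<n] \<in> {x \<in> Kn n. \<exists>a. a # x \<in> C})"
    by (simp add: Kn_def)
qed blast

text \<open>If \<open>y\<close> is in the closure of the projection, the lower limit over \<open>x \<rightarrow> y\<close> of the infimum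
  of the fibre over \<open>x\<close> gives a point of the fibre over \<open>y\<close>.\<close>

lemma closedin_drop_first:
  fixes M :: "('f, 'r, 'k::linordered_field) expansion"
  assumes M: "definably_complete M" and def: "definable M (Suc n) C"
    and closed: "closedin (Kn_top (Suc n)) C" and bounded: "\<And>x. x \<in> C \<Longrightarrow> \<bar>x ! 0\<bar> \<le> b"
  shows "closedin (Kn_top n) {x \<in> Kn n. \<exists>a. a # x \<in> C}"
  unfolding closedin_Kn_top_iff
proof (intro conjI ballI impI)
  fix y assume y: "y \<in> Kn n" and "\<forall>\<epsilon>>0. \<exists>x\<in>{x \<in> Kn n. \<exists>a. a # x \<in> C}. l1_dist n x y < \<epsilon>"
  then have near: "\<exists>a x. a # x \<in> C \<and> l1_dist n x y < \<epsilon>" if "0 < \<epsilon>" for \<epsilon>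
    using that by blast
  have CK: "C \<subseteq> Kn (Suc n)" and lim: "\<And>z. z \<in> Kn (Suc n) \<Longrightarrow>
      (\<And>\<epsilon>. 0 < \<epsilon> \<Longrightarrow> \<exists>x\<in>C. l1_dist (Suc n) x z < \<epsilon>) \<Longrightarrow> z \<in> C"
    using closed unfolding closedin_Kn_top_iff by blast+
  \<comment> \<open>\<open>P a\<close> says that \<open>a\<close> bounds from below the first
    coordinates of all points of \<open>C\<close> over some ball about \<open>y\<close>; its
    supremum is the lower limit. A single list variable is used to fit
    \<open>definable_pred_all_list\<close>; the fact \<open>P\<close> then splits it into head and
    tail.\<close>
  define P where "P a \<longleftrightarrow> (\<exists>t. 0 < t \<and> (\<forall>x\<in>Kn (Suc n). x \<in> C \<and> l1_dist n (tl x) y < t \<longrightarrow> a \<le> x ! 0))" for a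
  have P: "P a \<longleftrightarrow> (\<exists>t>0. \<forall>c x. c # x \<in> C \<and> l1_dist n x y < t \<longrightarrow> a \<le> c)" for a
  proof
    show "\<exists>t>0. \<forall>c x. c # x \<in> C \<and> l1_dist n x y < t \<longrightarrow> a \<le> c" if a: "P a"
    proof -
      obtain t where t: "0 < t" "\<And>x. x \<in> C \<Longrightarrow> l1_dist n (tl x) y < t \<Longrightarrow> a \<le> x ! 0"
        using a CK unfolding P_def by blast
      have "a \<le> c" if "c # x \<in> C" "l1_dist n x y < t" for c x
        using t(2)[of "c # x"] that by simp
      with t(1) show ?thesis by blast
    qed
    show "P a" if a: "\<exists>t>0. \<forall>c x. c # x \<in> C \<and> l1_dist n x y < t \<longrightarrow> a \<le> c"
    proof -
      obtain t where t: "0 < t" "\<And>c x. c # x \<in> C \<Longrightarrow> l1_dist n x y < t \<Longrightarrow> a \<le> c"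
        using a by blast
      have "a \<le> x ! 0" if "x \<in> Kn (Suc n)" "x \<in> C" "l1_dist n (tl x) y < t" for x
        using that t(2) by (auto elim!: Kn_SucE)
      with t(1) show ?thesis unfolding P_def by (intro exI[of _ t]) simp
    qed
  qed
  have "definable_pred M (\<lambda>e. P (e 0))"
    unfolding P_def
    by (intro definable_pred_ex definable_pred_all_list definable_pred_intros
        definable_pred_mem[OF def] definable_fun_l1_dist)
      (auto simp: nth_tl simp del: upt_Suc intro: definable_fun_atomic)
  moreover have "P (- b)"
    unfolding P using bounded by (intro exI[of _ 1]) (fastforce simp: abs_le_iff)
  moreover have "a \<le> b" if "P a" for a
  proof -
    obtain t where "t > 0" "\<And>c x. c # x \<in> C \<Longrightarrow> l1_dist n x y < t \<Longrightarrow> a \<le> c"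
      using \<open>P a\<close> unfolding P by blast
    moreover obtain c x where "c # x \<in> C" "l1_dist n x y < t" using near \<open>t > 0\<close> by blast
    moreover from this have "c \<le> b" using bounded[of "c # x"] by simp
    ultimately show ?thesis by fastforce
  qed
  ultimately obtain s where s: "\<And>a. P a \<Longrightarrow> a \<le> s" "\<And>u. (\<And>a. P a \<Longrightarrow> a \<le> u) \<Longrightarrow> s \<le> u"
    using definable_complete_sup[OF M, of P] by blast
  have "s # y \<in> C"
  proof (rule lim)
    show "s # y \<in> Kn (Suc n)" using y by (simp add: Kn_def)
    fix \<epsilon> :: 'k assume \<epsilon>: "0 < \<epsilon>"
    obtain a where a: "P a" "s - \<epsilon> / 2 < a"
    proof -
      have "\<not> s \<le> s - \<epsilon> / 2" using \<epsilon> by simp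
      then show ?thesis using s(2)[of "s - \<epsilon> / 2"] that by (meson not_le)
    qed
    then obtain t where t: "t > 0" "\<And>c x. c # x \<in> C \<Longrightarrow> l1_dist n x y < t \<Longrightarrow> a \<le> c"
      unfolding P by blast
    \<comment> \<open>The failure of \<open>P\<close> for the radius
      \<open>min t (\<epsilon> / 2)\<close> yields a point of \<open>C\<close> over a point near
      \<open>y\<close> with head below s + \<epsilon>/2. As the radius is at most \<open>t\<close>,
      the head is also at least a > s - \<epsilon>/2.\<close>
    have "\<not> P (s + \<epsilon> / 2)" using s(1)[of "s + \<epsilon> / 2"] \<epsilon> by auto
    moreover have "0 < min t (\<epsilon> / 2)" using t(1) \<epsilon> by simp
    ultimately obtain c x where x: "c # x \<in> C" "l1_dist n x y < min t (\<epsilon> / 2)" "c < s + \<epsilon> / 2"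
      unfolding P by (meson not_le)
    have "a \<le> c" using t(2) x by simp
    then have "\<bar>c - s\<bar> < \<epsilon> / 2" using x(3) a(2) unfolding abs_less_iff by linarith
    then have "l1_dist (Suc n) (c # x) (s # y) < \<epsilon>"
      unfolding l1_dist_Cons using x(2) by simp
    then show "\<exists>x\<in>C. l1_dist (Suc n) x (s # y) < \<epsilon>" using x(1) by blast
  qed
  with y show "y \<in> {x \<in> Kn n. \<exists>a. a # x \<in> C}" by blast
qed blast

text \<open>This replaces compactness. Dropping the first coordinate keeps the set definable, closed
  and bounded and preserves the last coordinate, so the induction descends to a subset of the line,
  where the infimum belongs to the closed set. A minimiser in the projection is lifted to any point
  above it.\<close>

lemma definable_attains_min_last:
  fixes M :: "('f, 'r, 'k::linordered_field) expansion"
  assumes M: "definably_complete M" and "definable M (Suc n) C" "closedin (Kn_top (Suc n)) C" "C \<noteq> {}"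
    and "\<And>x i. x \<in> C \<Longrightarrow> i \<le> n \<Longrightarrow> \<bar>x ! i\<bar> \<le> b"
  shows "\<exists>x\<in>C. \<forall>y\<in>C. x ! n \<le> y ! n"
  using assms(2-)
proof (induction n arbitrary: C)
  case 0
  have CK: "C \<subseteq> Kn 1" and lim: "\<And>z. z \<in> Kn 1 \<Longrightarrow>
      (\<And>\<epsilon>. 0 < \<epsilon> \<Longrightarrow> \<exists>x\<in>C. l1_dist 1 x z < \<epsilon>) \<Longrightarrow> z \<in> C"
    using 0(2) unfolding closedin_Kn_top_iff by auto
  \<comment> \<open>Definable completeness speaks of suprema, so the infimum is obtained as the
    supremum of the lower bounds.\<close>
  define P where "P a \<longleftrightarrow> (\<forall>x\<in>Kn 1. x \<in> C \<longrightarrow> a \<le> x ! 0)" for a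
  have "definable M 1 C" using 0(1) by simp
  then have "definable_pred M (\<lambda>e. P (e 0))"
    unfolding P_def
    by (intro definable_pred_all_list definable_pred_intros definable_pred_mem atomic_list_coords')
      (auto intro: definable_fun_atomic)
  moreover have P: "P a \<longleftrightarrow> (\<forall>x\<in>C. a \<le> x ! 0)" for a using CK by (auto simp: P_def)
  moreover have "P (- b)" unfolding P using 0(4) by (force simp: abs_le_iff)
  moreover obtain x0 where "x0 \<in> C" using 0(3) by blast
  ultimately obtain s where s: "\<And>a. P a \<Longrightarrow> a \<le> s" "\<And>u. (\<And>a. P a \<Longrightarrow> a \<le> u) \<Longrightarrow> s \<le> u"
    using definable_complete_sup[OF M, of P "- b" "x0 ! 0"] by blast
  have lower: "s \<le> x ! 0" if "x \<in> C" for x using s(2) that unfolding P by blast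
  have "[s] \<in> C"
  proof (rule lim)
    show "[s] \<in> Kn 1" by (simp add: Kn_def)
    fix \<epsilon> :: 'k assume "0 < \<epsilon>"
    then have "\<not> P (s + \<epsilon>)" using s(1)[of "s + \<epsilon>"] by auto
    then obtain x where "x \<in> C" "x ! 0 < s + \<epsilon>" unfolding P by (meson not_le)
    then show "\<exists>x\<in>C. l1_dist 1 x [s] < \<epsilon>"
      using lower by (intro bexI[of _ x]) (auto simp: l1_dist_def abs_less_iff)
  qed
  then show ?case using lower by (intro bexI[of _ "[s]"]) auto
next
  case (Suc n)
  let ?C = "{x \<in> Kn (Suc n). \<exists>a. a # x \<in> C}"
  have CK: "C \<subseteq> Kn (Suc (Suc n))" using Suc.prems(2) unfolding closedin_Kn_top_iff by blast
  have "\<exists>x\<in>?C. \<forall>y\<in>?C. x ! n \<le> y ! n"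
  proof (rule Suc.IH)
    show "definable M (Suc n) ?C" by (rule definable_drop_first[OF Suc.prems(1)])
    show "closedin (Kn_top (Suc n)) ?C"
      using Suc.prems by (intro closedin_drop_first[OF M]) auto
    obtain x where "x \<in> C" using Suc.prems(3) by blast
    moreover from this obtain a y where "x = a # y" "y \<in> Kn (Suc n)" using CK by (blast elim: Kn_SucE)
    ultimately show "?C \<noteq> {}" by blast
    show "\<bar>x ! i\<bar> \<le> b" if "x \<in> ?C" "i \<le> n" for x i
    proof -
      obtain a where "a # x \<in> C" using \<open>x \<in> ?C\<close> by blast
      from Suc.prems(4)[OF this, of "Suc i"] show ?thesis using \<open>i \<le> n\<close> by simp
    qed
  qed
  then obtain x a where x: "a # x \<in> C" "\<And>y. y \<in> ?C \<Longrightarrow> x ! n \<le> y ! n" by blast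
  show ?case
  proof (intro bexI[OF _ x(1)] ballI)
    fix y assume "y \<in> C"
    with CK obtain c z where "y = c # z" "z \<in> Kn (Suc n)" by (blast elim: Kn_SucE)
    then show "(a # x) ! Suc n \<le> y ! Suc n" using x(2)[of z] \<open>y \<in> C\<close> by auto
  qed
qed

section \<open>Pointwise strict differentiability\<close>

text \<open>Near \<open>a\<close> the difference quotients at every single point are close to \<open>c\<close>.  This lies
  between $C^1$ and strict differentiability: it follows from $C^1$ without a mean value theorem,
  and it suffices for the open mapping argument.\<close>

definition strict_gradient ::
  "nat \<Rightarrow> ('k::linordered_field list \<Rightarrow> 'k) \<Rightarrow> 'k list \<Rightarrow> (nat \<Rightarrow> 'k) \<Rightarrow> bool" where
  "strict_gradient n g a c \<longleftrightarrow>
     (\<forall>\<epsilon>>0. \<forall>\<^sub>F x in nhds_Kn n a. \<forall>\<^sub>F y in nhds_Kn n x.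
        \<bar>g y - g x - (\<Sum>i<n. c i * (y ! i - x ! i))\<bar> \<le> \<epsilon> * l1_dist n y x)"

lemma strict_gradient_cong:
  assumes "strict_gradient n g a c" "\<forall>\<^sub>F x in nhds_Kn n a. g x = g' x"
  shows "strict_gradient n g' a c"
  unfolding strict_gradient_def
proof (intro allI impI)
  fix \<epsilon> :: 'a assume "0 < \<epsilon>"
  then have "\<forall>\<^sub>F x in nhds_Kn n a. \<forall>\<^sub>F y in nhds_Kn n x.
      \<bar>g y - g x - (\<Sum>i<n. c i * (y ! i - x ! i))\<bar> \<le> \<epsilon> * l1_dist n y x"
    using assms(1) unfolding strict_gradient_def by blast
  with assms(2) eventually_eventually_nhdsin[OF assms(2)]
  show "\<forall>\<^sub>F x in nhds_Kn n a. \<forall>\<^sub>F y in nhds_Kn n x.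
      \<bar>g' y - g' x - (\<Sum>i<n. c i * (y ! i - x ! i))\<bar> \<le> \<epsilon> * l1_dist n y x"
  proof eventually_elim
    case (elim x)
    from elim(2,3) show ?case by eventually_elim (simp add: elim(1))
  qed
qed

lemma strict_gradient_cong_ex:
  assumes "\<exists>c. strict_gradient n g a c" "\<forall>\<^sub>F x in nhds_Kn n a. g x = g' x"
  shows "\<exists>c. strict_gradient n g' a c"
  using assms(1) strict_gradient_cong[OF _ assms(2)] by (elim ex_forward)

lemma strict_gradient_nth:
  assumes "k < n"
  shows "strict_gradient n (\<lambda>z. z ! k) a (\<lambda>i. if i = k then 1 else 0)"
proof -
  have "(\<Sum>i<n. (if i = k then 1 else 0) * (y ! i - x ! i)) = y ! k - x ! k" for x y :: "'a list"
    using assms by (simp add: if_distrib[of "\<lambda>c. c * _"] cong: if_cong)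
  then show ?thesis unfolding strict_gradient_def by simp
qed

lemma strict_gradient_const: "strict_gradient n (\<lambda>z. b) a (\<lambda>i. 0)"
  unfolding strict_gradient_def by simp

lemma abs_sum_mult_le_l1_dist:
  assumes "\<And>i. i < n \<Longrightarrow> \<bar>c i\<bar> \<le> C"
  shows "\<bar>\<Sum>i<n. c i * (y ! i - x ! i)\<bar> \<le> C * l1_dist n y x"
proof -
  have "\<bar>\<Sum>i<n. c i * (y ! i - x ! i)\<bar> \<le> (\<Sum>i<n. \<bar>c i * (y ! i - x ! i)\<bar>)"
    by (rule sum_abs)
  also have "\<dots> \<le> (\<Sum>i<n. C * \<bar>y ! i - x ! i\<bar>)"
    unfolding abs_mult using assms by (intro sum_mono mult_right_mono) auto
  finally show ?thesis by (simp add: l1_dist_def sum_distrib_left)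
qed

lemma abs_le_sum_abs: "i < (n::nat) \<Longrightarrow> \<bar>c i\<bar> \<le> (\<Sum>i<n. \<bar>c i :: 'a::linordered_field\<bar>)"
  by (rule member_le_sum) auto

lemma strict_gradient_uniform:
  assumes "\<And>j. j < (m::nat) \<Longrightarrow> strict_gradient n (u j) a (c j)" "0 < \<epsilon>"
  shows "\<forall>\<^sub>F x in nhds_Kn n a. \<forall>\<^sub>F y in nhds_Kn n x. \<forall>j<m.
      \<bar>u j y - u j x - (\<Sum>i<n. c j i * (y ! i - x ! i))\<bar> \<le> \<epsilon> * l1_dist n y x"
proof -
  have "\<forall>\<^sub>F x in nhds_Kn n a. \<forall>j\<in>{..<m}. \<forall>\<^sub>F y in nhds_Kn n x.
      \<bar>u j y - u j x - (\<Sum>i<n. c j i * (y ! i - x ! i))\<bar> \<le> \<epsilon> * l1_dist n y x"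
    using assms unfolding strict_gradient_def by (intro eventually_ball_finite) auto
  then show ?thesis
  proof eventually_elim
    case (elim x)
    then have "\<forall>\<^sub>F y in nhds_Kn n x. \<forall>j\<in>{..<m}.
        \<bar>u j y - u j x - (\<Sum>i<n. c j i * (y ! i - x ! i))\<bar> \<le> \<epsilon> * l1_dist n y x"
      by (intro eventually_ball_finite) auto
    then show ?case by (rule eventually_mono) auto
  qed
qed

text \<open>Tolerance 1 in each component bounds its change by 1 plus the l1 norm of its gradient,
  times the distance. The bound is pointwise: the neighbourhood of \<open>x\<close> in which
  \<open>y\<close> ranges depends on \<open>x\<close>. This still gives continuity at every
  \<open>x\<close> near \<open>a\<close>.\<close>

lemma strict_gradient_lipschitz:
  assumes "\<And>j. j < m \<Longrightarrow> strict_gradient n (\<lambda>x. u x ! j) a (c j)"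
  shows "\<exists>K>0. \<forall>\<^sub>F x in nhds_Kn n a. \<forall>\<^sub>F y in nhds_Kn n x. l1_dist m (u y) (u x) \<le> K * l1_dist n y x"
proof -
  define L where "L j = 1 + (\<Sum>i<n. \<bar>c j i\<bar>)" for j
  have L: "0 < L j" for j unfolding L_def by (intro add_pos_nonneg sum_nonneg) auto
  have "\<forall>\<^sub>F x in nhds_Kn n a. \<forall>\<^sub>F y in nhds_Kn n x. l1_dist m (u y) (u x) \<le> (1 + (\<Sum>j<m. L j)) * l1_dist n y x"
    using strict_gradient_uniform[of m n "\<lambda>j x. u x ! j" a c, OF assms zero_less_one]
  proof (rule eventually_mono)
    fix x assume "\<forall>\<^sub>F y in nhds_Kn n x. \<forall>j<m.
      \<bar>u y ! j - u x ! j - (\<Sum>i<n. c j i * (y ! i - x ! i))\<bar> \<le> 1 * l1_dist n y x"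
    then show "\<forall>\<^sub>F y in nhds_Kn n x. l1_dist m (u y) (u x) \<le> (1 + (\<Sum>j<m. L j)) * l1_dist n y x"
    proof (rule eventually_mono)
      fix y assume y: "\<forall>j<m. \<bar>u y ! j - u x ! j - (\<Sum>i<n. c j i * (y ! i - x ! i))\<bar> \<le> 1 * l1_dist n y x"
      have "\<bar>u y ! j - u x ! j\<bar> \<le> L j * l1_dist n y x" if "j < m" for j
        using y[rule_format, OF that]
          abs_sum_mult_le_l1_dist[of n "c j" "\<Sum>i<n. \<bar>c j i\<bar>" y x, OF abs_le_sum_abs]
        by (simp add: L_def distrib_right)
      then have "l1_dist m (u y) (u x) \<le> (\<Sum>j<m. L j * l1_dist n y x)"
        unfolding l1_dist_def[of m] by (intro sum_mono) simp
      also have "\<dots> \<le> (1 + (\<Sum>j<m. L j)) * l1_dist n y x"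
        by (simp add: sum_distrib_right distrib_right)
      finally show "l1_dist m (u y) (u x) \<le> (1 + (\<Sum>j<m. L j)) * l1_dist n y x" .
    qed
  qed
  \<comment> \<open>The summand 1 keeps the constant positive for m = 0, so that later divisions by
    it are legitimate.\<close>
  moreover have "0 < 1 + (\<Sum>j<m. L j)" using L by (intro add_pos_nonneg sum_nonneg) (auto intro: less_imp_le)
  ultimately show ?thesis by blast
qed

lemma lipschitz_filterlim:
  assumes "x \<in> Kn n" "u x \<in> Kn m" "\<forall>\<^sub>F y in nhds_Kn n x. u y \<in> Kn m" "0 < K"
    and "\<forall>\<^sub>F y in nhds_Kn n x. l1_dist m (u y) (u x) \<le> K * l1_dist n y x"
  shows "filterlim u (nhds_Kn m (u x)) (nhds_Kn n x)"
proof (rule filterlim_nhds_Kn[OF assms(2,3)])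
  fix \<epsilon> :: 'a assume "0 < \<epsilon>"
  then have "\<forall>\<^sub>F y in nhds_Kn n x. l1_dist n y x < \<epsilon> / K"
    using assms by (intro eventually_l1_dist_less) auto
  with assms(5) show "\<forall>\<^sub>F y in nhds_Kn n x. l1_dist m (u y) (u x) < \<epsilon>"
  proof eventually_elim
    case (elim y)
    then show ?case using assms(4) by (simp add: field_simps)
  qed
qed

lemma strict_gradient_filterlim:
  assumes "a \<in> Kn n" "\<forall>\<^sub>F y in nhds_Kn n a. u y \<in> Kn m"
    and ex: "\<And>j. j < m \<Longrightarrow> \<exists>c. strict_gradient n (\<lambda>x. u x ! j) a c"
  shows "filterlim u (nhds_Kn m (u a)) (nhds_Kn n a)"
proof -
  obtain c where c: "\<And>j. j < m \<Longrightarrow> strict_gradient n (\<lambda>x. u x ! j) a (c j)" using ex by metis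
  obtain K where "K > 0" 
      "\<forall>\<^sub>F x in nhds_Kn n a. \<forall>\<^sub>F y in nhds_Kn n x. l1_dist m (u y) (u x) \<le> K * l1_dist n y x"
    using strict_gradient_lipschitz[of m n u a c, OF c] by blast
  then show ?thesis
    using assms(1,2) by (intro lipschitz_filterlim[of a n u m K])
      (auto dest: eventually_nhdsin_self)
qed

text \<open>The chain rule. The error splits into that of \<open>g\<close> at \<open>u x\<close> and
  the image under \<open>b\<close> of the errors of the components of \<open>u\<close>; each gets
  half of \<epsilon>. Nested neighbourhoods require continuity of \<open>u\<close> twice: at
  \<open>a\<close> to reach nearby base points \<open>u x\<close>, and at \<open>x\<close> to reach
  \<open>u y\<close> from there.\<close>

lemma strict_gradient_compose:
  assumes a: "a \<in> Kn n" and u: "\<forall>\<^sub>F y in nhds_Kn n a. u y \<in> Kn m"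
    and c: "\<And>j. j < m \<Longrightarrow> strict_gradient n (\<lambda>x. u x ! j) a (c j)"
    and b: "strict_gradient m g (u a) b"
  shows "strict_gradient n (\<lambda>x. g (u x)) a (\<lambda>i. \<Sum>j<m. b j * c j i)"
  unfolding strict_gradient_def
proof (intro allI impI)
  fix \<epsilon> :: 'a assume \<epsilon>: "0 < \<epsilon>"
  obtain K where K: "K > 0" 
      "\<forall>\<^sub>F x in nhds_Kn n a. \<forall>\<^sub>F y in nhds_Kn n x. l1_dist m (u y) (u x) \<le> K * l1_dist n y x"
    using strict_gradient_lipschitz[of m n u a c, OF c] by blast
  define B where "B = 1 + (\<Sum>j<m. \<bar>b j\<bar>)"
  have B: "0 < B" unfolding B_def by (intro add_pos_nonneg sum_nonneg) auto
  have lim: "filterlim u (nhds_Kn m (u a)) (nhds_Kn n a)"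
    using c by (intro strict_gradient_filterlim[OF a u]) blast
  \<comment> \<open>\<open>K\<close> turns distances of images into distances of arguments, and
    \<open>B\<close> exceeds the l1 norm of \<open>b\<close>; the tolerances \<epsilon> / (2 K) and
    \<epsilon> / (2 B) then cost \<epsilon> / 2 each.\<close>
  have "0 < \<epsilon> / (2 * K)" using K(1) \<epsilon> by simp
  then have "\<forall>\<^sub>F x in nhds_Kn m (u a). \<forall>\<^sub>F y in nhds_Kn m x.
      \<bar>g y - g x - (\<Sum>i<m. b i * (y ! i - x ! i))\<bar> \<le> \<epsilon> / (2 * K) * l1_dist m y x"
    by (rule b[unfolded strict_gradient_def, rule_format])
  then have g: "\<forall>\<^sub>F x in nhds_Kn n a. \<forall>\<^sub>F y in nhds_Kn m (u x).
      \<bar>g y - g (u x) - (\<Sum>i<m. b i * (y ! i - u x ! i))\<bar> \<le> \<epsilon> / (2 * K) * l1_dist m y (u x)"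
    using lim unfolding filterlim_iff by blast
  have "\<forall>\<^sub>F x in nhds_Kn n a. \<forall>\<^sub>F y in nhds_Kn n x. \<forall>j<m.
      \<bar>u y ! j - u x ! j - (\<Sum>i<n. c j i * (y ! i - x ! i))\<bar> \<le> \<epsilon> / (2 * B) * l1_dist n y x"
    by (rule strict_gradient_uniform) (use c B \<epsilon> in auto)
  with K(2) g u eventually_eventually_nhdsin[OF u] eventually_in_Kn
  show "\<forall>\<^sub>F x in nhds_Kn n a. \<forall>\<^sub>F y in nhds_Kn n x.
      \<bar>g (u y) - g (u x) - (\<Sum>i<n. (\<Sum>j<m. b j * c j i) * (y ! i - x ! i))\<bar> \<le> \<epsilon> * l1_dist n y x"
  proof eventually_elim
    case (elim x)
    \<comment> \<open>Continuity at the nearby point \<open>x\<close>, where no gradient of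
      \<open>u\<close> is available, comes from the pointwise Lipschitz bound at
      \<open>x\<close>.\<close>
    have "filterlim u (nhds_Kn m (u x)) (nhds_Kn n x)"
      by (rule lipschitz_filterlim) (use elim K(1) in auto)
    then have "\<forall>\<^sub>F y in nhds_Kn n x.
        \<bar>g (u y) - g (u x) - (\<Sum>i<m. b i * (u y ! i - u x ! i))\<bar> \<le> \<epsilon> / (2 * K) * l1_dist m (u y) (u x)"
      using elim(2) unfolding filterlim_iff by blast
    with elim(1,6) show ?case
    proof eventually_elim
      case (elim y)
      let ?D = "l1_dist n y x"
      define r where "r j = u y ! j - u x ! j - (\<Sum>i<n. c j i * (y ! i - x ! i))" for j
      have "(\<Sum>i<n. (\<Sum>j<m. b j * c j i) * (y ! i - x ! i)) =
          (\<Sum>j<m. b j * (\<Sum>i<n. c j i * (y ! i - x ! i)))"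
        unfolding sum_distrib_left sum_distrib_right
        by (subst sum.swap) (simp add: mult.assoc)
      then have eq: "g (u y) - g (u x) - (\<Sum>i<n. (\<Sum>j<m. b j * c j i) * (y ! i - x ! i)) =
          (g (u y) - g (u x) - (\<Sum>i<m. b i * (u y ! i - u x ! i))) + (\<Sum>j<m. b j * r j)"
        unfolding r_def by (simp add: right_diff_distrib sum_subtractf)
      have "\<bar>\<Sum>j<m. b j * r j\<bar> \<le> (\<Sum>j<m. \<bar>b j\<bar> * (\<epsilon> / (2 * B) * ?D))"
      proof (rule order_trans[OF sum_abs], rule sum_mono)
        fix j assume "j \<in> {..<m}"
        then show "\<bar>b j * r j\<bar> \<le> \<bar>b j\<bar> * (\<epsilon> / (2 * B) * ?D)"
          unfolding abs_mult r_def using elim(2) by (intro mult_left_mono) auto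
      qed
      also have "\<dots> = (B - 1) * (\<epsilon> / (2 * B) * ?D)"
        by (simp only: B_def sum_distrib_right add_diff_cancel_left')
      also have "\<dots> \<le> B * (\<epsilon> / (2 * B) * ?D)"
        using \<epsilon> B by (intro mult_right_mono mult_nonneg_nonneg) auto
      also have "\<dots> = \<epsilon> / 2 * ?D" using B by simp
      finally have 1: "\<bar>\<Sum>j<m. b j * r j\<bar> \<le> \<epsilon> / 2 * ?D" .
      have "\<epsilon> / (2 * K) * l1_dist m (u y) (u x) \<le> \<epsilon> / (2 * K) * (K * ?D)"
        using elim(1) \<epsilon> K(1) by (intro mult_left_mono) auto
      also have "\<dots> = \<epsilon> / 2 * ?D" using K(1) by simp
      finally have "\<bar>g (u y) - g (u x) - (\<Sum>i<m. b i * (u y ! i - u x ! i))\<bar> \<le> \<epsilon> / 2 * ?D"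
        using elim(3) by (rule order_trans[rotated])
      moreover have "\<epsilon> * ?D = \<epsilon> / 2 * ?D + \<epsilon> / 2 * ?D" by (simp add: field_simps)
      ultimately show ?case unfolding eq using 1 by linarith
    qed
  qed
qed

lemma strict_gradient_compose_ex:
  assumes a: "a \<in> Kn n" and u: "\<forall>\<^sub>F y in nhds_Kn n a. u y \<in> Kn m"
    and c: "\<And>j. j < m \<Longrightarrow> \<exists>c. strict_gradient n (\<lambda>x. u x ! j) a c"
    and b: "\<exists>b. strict_gradient m g (u a) b"
  shows "\<exists>c. strict_gradient n (\<lambda>x. g (u x)) a c"
proof -
  obtain c' where "\<And>j. j < m \<Longrightarrow> strict_gradient n (\<lambda>x. u x ! j) a (c' j)" using c by metis
  then show ?thesis using strict_gradient_compose[OF a u] b by blast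
qed

lemma l1_dist_list_update:
  assumes "k < n" "a \<in> Kn n"
  shows "l1_dist n (a[k := b]) a = \<bar>b - a ! k\<bar>"
proof -
  have "l1_dist n (a[k := b]) a = (\<Sum>i<n. if i = k then \<bar>b - a ! k\<bar> else 0)"
    unfolding l1_dist_def using assms by (intro sum.cong) (auto simp: nth_list_update Kn_def)
  then show ?thesis using assms by simp
qed

text \<open>The equation \<open>y = a[k := y ! k]\<close> places \<open>y\<close> on the line
  through \<open>a\<close> parallel to the k-th axis, along which \<open>g\<close> is affine with
  slope \<delta> near \<open>a\<close>. A point of this line tested with tolerance \<bar>\<delta> -
  c k\<bar> / 2 gives \<bar>\<delta> - c k\<bar> \<le> \<bar>\<delta> - c k\<bar> / 2. Thus a
  gradient known to exist is computed from restrictions to lines.\<close>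

lemma strict_gradient_partial:
  assumes g: "strict_gradient n g a c" and a: "a \<in> Kn n" "k < n"
    and \<delta>: "\<forall>\<^sub>F y in nhds_Kn n a. y = a[k := y ! k] \<longrightarrow> g y - g a = \<delta> * (y ! k - a ! k)"
  shows "c k = \<delta>"
proof (rule ccontr)
  assume "c k \<noteq> \<delta>"
  then have "0 < \<bar>\<delta> - c k\<bar> / 2" by simp
  then have "\<forall>\<^sub>F x in nhds_Kn n a. \<forall>\<^sub>F y in nhds_Kn n x.
      \<bar>g y - g x - (\<Sum>i<n. c i * (y ! i - x ! i))\<bar> \<le> \<bar>\<delta> - c k\<bar> / 2 * l1_dist n y x"
    by (rule g[unfolded strict_gradient_def, rule_format])
  then have "\<forall>\<^sub>F y in nhds_Kn n a.
      \<bar>g y - g a - (\<Sum>i<n. c i * (y ! i - a ! i))\<bar> \<le> \<bar>\<delta> - c k\<bar> / 2 * l1_dist n y a"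
    by (rule eventually_nhdsin_self) (simp add: a)
  with \<delta> have "\<forall>\<^sub>F y in nhds_Kn n a. (y = a[k := y ! k] \<longrightarrow> g y - g a = \<delta> * (y ! k - a ! k)) \<and>
      \<bar>g y - g a - (\<Sum>i<n. c i * (y ! i - a ! i))\<bar> \<le> \<bar>\<delta> - c k\<bar> / 2 * l1_dist n y a"
    by (rule eventually_conj)
  then obtain \<rho> where \<rho>: "\<rho> > 0"
      "\<And>y. y \<in> Kn n \<Longrightarrow> l1_dist n y a < \<rho> \<Longrightarrow> (y = a[k := y ! k] \<longrightarrow> g y - g a = \<delta> * (y ! k - a ! k)) \<and>
      \<bar>g y - g a - (\<Sum>i<n. c i * (y ! i - a ! i))\<bar> \<le> \<bar>\<delta> - c k\<bar> / 2 * l1_dist n y a"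
    using a(1) unfolding eventually_nhds_Kn[OF a(1)] by blast
  define y where "y = a[k := a ! k + \<rho> / 2]"
  have y: "y \<in> Kn n" "y ! k = a ! k + \<rho> / 2" "l1_dist n y a = \<rho> / 2"
    using a \<rho>(1) by (auto simp: y_def Kn_def l1_dist_list_update)
  have "(\<Sum>i<n. c i * (y ! i - a ! i)) = (\<Sum>i<n. if i = k then c k * (\<rho> / 2) else 0)"
    using a by (intro sum.cong) (auto simp: y_def nth_list_update Kn_def)
  also have "\<dots> = c k * (\<rho> / 2)" using a(2) by simp
  finally have sum: "(\<Sum>i<n. c i * (y ! i - a ! i)) = c k * (\<rho> / 2)" .
  have "g y - g a = \<delta> * (\<rho> / 2)"
    using \<rho>(2)[OF y(1)] \<rho>(1) y(2,3) by (simp add: y_def)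
  moreover have "\<bar>g y - g a - (\<Sum>i<n. c i * (y ! i - a ! i))\<bar> \<le> \<bar>\<delta> - c k\<bar> / 2 * l1_dist n y a"
  proof -
    have "l1_dist n y a < \<rho>" using \<rho>(1) y(3) by simp
    then show ?thesis using \<rho>(2)[OF y(1)] by blast
  qed
  ultimately have "\<bar>\<delta> * (\<rho> / 2) - c k * (\<rho> / 2)\<bar> \<le> \<bar>\<delta> - c k\<bar> / 2 * (\<rho> / 2)"
    by (simp only: sum y(3))
  then have "\<bar>(\<delta> - c k) * (\<rho> / 2)\<bar> \<le> \<bar>\<delta> - c k\<bar> / 2 * (\<rho> / 2)"
    by (simp only: left_diff_distrib)
  then show False using \<open>c k \<noteq> \<delta>\<close> \<rho>(1) by (simp add: abs_mult)
qed

text \<open>Differentiability at \<open>x\<close> compares \<open>g y - g x\<close> with the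
  gradient at \<open>x\<close> up to \<epsilon>/2, for \<open>y\<close> close to this
  \<open>x\<close>. Continuity of the gradient then replaces its value at \<open>x\<close> by that
  at \<open>a\<close>, at the cost of another \<epsilon>/2.\<close>

lemma strict_gradient_C1:
  assumes U: "openin (Kn_top n) U" and g: "Ck_scalar n (Suc 0) U g" and a: "a \<in> U"
  shows "\<exists>c. strict_gradient n g a c"
proof -
  obtain h where h: "\<And>x. x \<in> U \<Longrightarrow> has_gradient n U g x (\<lambda>i. h i x)"
      "\<And>i. i < n \<Longrightarrow> continuous_map (subtopology (Kn_top n) U) (Kn_top 1) (\<lambda>x. [h i x])"
    using g by auto
  have UK: "U \<subseteq> Kn n" using openin_subset[OF U] by simp
  have cont: "\<forall>\<^sub>F x in nhds_Kn n a. \<bar>h i x - h i a\<bar> < \<epsilon>" if "i < n" "0 < \<epsilon>" for i \<epsilon>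
  proof -
    have "filterlim (\<lambda>x. [h i x]) (nhds_Kn 1 [h i a]) (nhds_Kn n a)"
      using continuous_map_imp_filterlim_nhdsin[OF h(2)[OF that(1)], of a] a UK
      unfolding nhdsin_open_subtopology[OF U a] by auto
    moreover have "\<forall>\<^sub>F z in nhds_Kn 1 [h i a]. l1_dist 1 z [h i a] < \<epsilon>"
      using that by (intro eventually_l1_dist_less) (auto simp: Kn_def)
    ultimately have "\<forall>\<^sub>F x in nhds_Kn n a. l1_dist 1 [h i x] [h i a] < \<epsilon>"
      unfolding filterlim_iff by blast
    then show ?thesis by (simp add: l1_dist_def)
  qed
  have "strict_gradient n g a (\<lambda>i. h i a)"
    unfolding strict_gradient_def
  proof (intro allI impI)
    fix \<epsilon> :: 'a assume \<epsilon>: "0 < \<epsilon>"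
    have "\<forall>\<^sub>F x in nhds_Kn n a. \<forall>i\<in>{..<n}. \<bar>h i x - h i a\<bar> < \<epsilon> / 2"
      using \<epsilon> by (intro eventually_ball_finite ballI cont) auto
    then show "\<forall>\<^sub>F x in nhds_Kn n a. \<forall>\<^sub>F y in nhds_Kn n x.
        \<bar>g y - g x - (\<Sum>i<n. h i a * (y ! i - x ! i))\<bar> \<le> \<epsilon> * l1_dist n y x"
      using eventually_in_openin[OF U a]
    proof eventually_elim
      case (elim x)
      obtain \<delta> where "\<delta> > 0" and \<delta>: "\<And>y. y \<in> U \<Longrightarrow> l1_dist n y x < \<delta> \<Longrightarrow>
          \<bar>g y - g x - (\<Sum>i<n. h i x * (y ! i - x ! i))\<bar> \<le> \<epsilon> / 2 * l1_dist n y x"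
        using h(1)[OF elim(2)] \<epsilon> unfolding has_gradient_def by (meson half_gt_zero)
      have "\<forall>\<^sub>F y in nhds_Kn n x. l1_dist n y x < \<delta>"
        using elim(2) UK \<open>\<delta> > 0\<close> by (intro eventually_l1_dist_less) auto
      then show ?case
        using eventually_in_openin[OF U elim(2)]
      proof eventually_elim
        case (elim y)
        have "\<bar>\<Sum>i<n. (h i x - h i a) * (y ! i - x ! i)\<bar> \<le> \<epsilon> / 2 * l1_dist n y x"
          using \<open>\<forall>i\<in>{..<n}. \<bar>h i x - h i a\<bar> < \<epsilon> / 2\<close>
          by (intro abs_sum_mult_le_l1_dist) (auto intro: less_imp_le)
        moreover have "(\<Sum>i<n. (h i x - h i a) * (y ! i - x ! i)) =
            (\<Sum>i<n. h i x * (y ! i - x ! i)) - (\<Sum>i<n. h i a * (y ! i - x ! i))"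
          by (simp add: left_diff_distrib sum_subtractf)
        moreover have "\<epsilon> * l1_dist n y x = \<epsilon> / 2 * l1_dist n y x + \<epsilon> / 2 * l1_dist n y x"
          by (simp add: field_simps)
        ultimately show ?case using \<delta>[OF elim(2,1)] by linarith
      qed
    qed
  qed
  then show ?thesis by blast
qed

section \<open>Graph charts\<close>

lemma definable_open_box:
  fixes M :: "('f, 'r, 'k::linordered_field) expansion"
  assumes "open_box n B"
  shows "definable M n B"
proof -
  obtain I where I: "\<And>i. i < n \<Longrightarrow> open_interval (I i)" "B = {x \<in> Kn n. \<forall>i<n. x ! i \<in> I i}"
    using assms(1) unfolding open_box_def by blast
  have "definable_pred M (\<lambda>e. \<forall>i<n. e i \<in> I i)"
  proof (rule definable_pred_all_less)
    fix i assume "i < n"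
    then consider c d where "I i = {c<..<d}" | c where "I i = {c<..}" | c where "I i = {..<c}" | "I i = UNIV"
      using I(1)[of i] unfolding open_interval_def by blast
    then show "definable_pred M (\<lambda>e. e i \<in> I i)"
    proof cases
      case 4
      then show ?thesis using definable_pred_atomic_eq[of "\<lambda>e. e 0" "\<lambda>e. e 0"] by simp
    qed (auto intro!: definable_pred_conj definable_pred_atomic_less)
  qed
  moreover have "map e [0..<n] \<in> B \<longleftrightarrow> (\<forall>i<n. e i \<in> I i)" for e :: "nat \<Rightarrow> 'k"
    by (auto simp: I(2) Kn_def)
  ultimately show ?thesis
    using open_box_subset_Kn[OF assms] by (intro definable_if_definable_pred) auto
qed

text \<open>Undoing the permutation turns the graph into a parametrization \<gamma> in ambient
  coordinates, whose inverse is the projection to the coordinates \<sigma> 0, ..., \<sigma> (d - 1).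
  Each component of \<gamma> is a coordinate of \<open>v\<close> or a component of \<open>f\<close>,
  hence strictly differentiable.\<close>

lemma embedded_manifold_graph_chart:
  fixes X :: "'k::linordered_field list set"
  assumes "embedded_manifold M 1 N d X" "x0 \<in> X"
  obtains U V \<sigma> \<gamma> where
    "open_box N U" "x0 \<in> U" "open_box d V" "\<And>j. j < d \<Longrightarrow> \<sigma> j < N"
    "\<And>v. v \<in> V \<Longrightarrow> \<gamma> v \<in> X \<inter> U \<and> map (\<lambda>j. \<gamma> v ! \<sigma> j) [0..<d] = v"
    "\<And>z. z \<in> X \<inter> U \<Longrightarrow> map (\<lambda>j. z ! \<sigma> j) [0..<d] \<in> V \<and> \<gamma> (map (\<lambda>j. z ! \<sigma> j) [0..<d]) = z"
    "\<And>i a. i < N \<Longrightarrow> a \<in> V \<Longrightarrow> \<exists>c. strict_gradient d (\<lambda>v. \<gamma> v ! i) a c"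
proof -
  from assms obtain U V W \<sigma> f where dN: "d \<le> N" and U: "open_box N U" "x0 \<in> U"
    and \<sigma>: "\<sigma> permutes {..<N}" and V: "open_box d V" and W: "open_box (N - d) W"
    and f: "f ` V \<subseteq> W" "Ck_open 1 d (N - d) V f"
    and graph: "permute_list \<sigma> ` (X \<inter> U) = {v @ f v | v. v \<in> V}"
    unfolding embedded_manifold_def
    by (elim conjE) (drule (1) bspec, elim exE conjE, rule that, assumption+)
  \<comment> \<open>Entry \<open>k\<close> of \<open>permute_list \<sigma> z\<close> is
    \<open>z ! \<sigma> k\<close>, so the ambient entry \<open>i\<close> stands at place \<sigma>' i
    of \<open>v @ f v\<close>.\<close>
  define \<sigma>' where "\<sigma>' = inv_into UNIV \<sigma>"
  have inverse: "\<sigma> (\<sigma>' i) = i" for i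
    unfolding \<sigma>'_def by (rule permutes_inverses(1)[OF \<sigma>])
  define \<gamma> where "\<gamma> v = map (\<lambda>i. (v @ f v) ! \<sigma>' i) [0..<N]" for v
  have len: "length z = N" if "z \<in> U" for z
    using open_box_subset_Kn[OF U(1)] that by (auto simp: Kn_def)
  have lenV: "length v = d" if "v \<in> V" for v
    using open_box_subset_Kn[OF V] that by (auto simp: Kn_def)
  have \<sigma>'N: "\<sigma>' i < N" if "i < N" for i
    using permutes_in_image[OF permutes_inv[OF \<sigma>], of i] that by (simp add: \<sigma>'_def)
  have \<sigma>N: "\<sigma> j < N" if "j < N" for j
    using permutes_in_image[OF \<sigma>, of j] that by simp
  have \<gamma>: "\<gamma> v = z" "map (\<lambda>j. z ! \<sigma> j) [0..<d] = v"
    if "z \<in> U" "v \<in> V" "permute_list \<sigma> z = v @ f v" for v z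
  proof -
    have nth: "(v @ f v) ! k = z ! \<sigma> k" if "k < N" for k
      using permute_list_nth[of \<sigma> z k] len[OF \<open>z \<in> U\<close>] \<sigma> that \<open>permute_list \<sigma> z = v @ f v\<close> by simp
    show "\<gamma> v = z"
      using len[OF \<open>z \<in> U\<close>] \<sigma>'N
      by (intro nth_equalityI) (auto simp: \<gamma>_def nth inverse)
    have "z ! \<sigma> k = v ! k" if "k < d" for k
      using nth[of k] that dN lenV[OF \<open>v \<in> V\<close>] by (simp add: nth_append)
    then show "map (\<lambda>j. z ! \<sigma> j) [0..<d] = v"
      using lenV[OF \<open>v \<in> V\<close>] by (intro nth_equalityI) auto
  qed
  show thesis
  proof (rule that[OF U V])
    show "\<sigma> j < N" if "j < d" for j using \<sigma>N that dN by simp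
    show "\<gamma> v \<in> X \<inter> U \<and> map (\<lambda>j. \<gamma> v ! \<sigma> j) [0..<d] = v" if v: "v \<in> V" for v
    proof -
      have "v @ f v \<in> permute_list \<sigma> ` (X \<inter> U)" using v graph by blast
      then obtain z where z: "z \<in> X \<inter> U" "permute_list \<sigma> z = v @ f v" by auto
      then have "\<gamma> v = z" "map (\<lambda>j. z ! \<sigma> j) [0..<d] = v" using \<gamma>[of z v] v by auto
      with z show ?thesis by simp
    qed
    show "map (\<lambda>j. z ! \<sigma> j) [0..<d] \<in> V \<and> \<gamma> (map (\<lambda>j. z ! \<sigma> j) [0..<d]) = z" if z: "z \<in> X \<inter> U" for z
    proof -
      have "permute_list \<sigma> z \<in> {v @ f v | v. v \<in> V}" using z graph by blast
      then obtain v where v: "v \<in> V" "permute_list \<sigma> z = v @ f v" by blast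
      then have "\<gamma> v = z" "map (\<lambda>j. z ! \<sigma> j) [0..<d] = v" using \<gamma>[of z v] z by auto
      with v show ?thesis by simp
    qed
    show "\<exists>c. strict_gradient d (\<lambda>v. \<gamma> v ! i) a c" if i: "i < N" and a: "a \<in> V" for i a
    proof -
      have near: "\<forall>\<^sub>F v in nhds_Kn d a. v \<in> V"
        by (rule eventually_in_openin[OF openin_Kn_top_open_box[OF V] a])
      have eq: "\<gamma> v ! i = (v @ f v) ! \<sigma>' i" for v using i by (simp add: \<gamma>_def)
      show ?thesis
      proof (cases "\<sigma>' i < d")
        case True
        have "\<forall>\<^sub>F v in nhds_Kn d a. v ! \<sigma>' i = \<gamma> v ! i"
          using near by eventually_elim (simp add: eq nth_append lenV True)
        then show ?thesis
          by (rule strict_gradient_cong_ex[rotated]) (rule exI, rule strict_gradient_nth[OF True])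
      next
        case False
        then have "\<sigma>' i - d < N - d" using \<sigma>'N[OF i] by simp
        then have "Ck_scalar d (Suc 0) V (\<lambda>x. f x ! (\<sigma>' i - d))"
          using f(2) unfolding Ck_open_def by simp
        then have "\<exists>c. strict_gradient d (\<lambda>x. f x ! (\<sigma>' i - d)) a c"
          by (rule strict_gradient_C1[OF openin_Kn_top_open_box[OF V] _ a])
        moreover have "\<forall>\<^sub>F v in nhds_Kn d a. f v ! (\<sigma>' i - d) = \<gamma> v ! i"
          using near by eventually_elim (simp add: eq nth_append lenV False)
        ultimately show ?thesis by (rule strict_gradient_cong_ex)
      qed
    qed
  qed
qed

section \<open>A chart of the group around the identity\<close>

locale group_chart = group G for G :: "('k::linordered_field list, 'm) monoid_scheme" (structure) +
  fixes M :: "('f, 'r, 'k) expansion" and n :: nat and \<tau> :: "'k list topology"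
    and d :: nat and V :: "'k list set" and \<phi> \<psi> :: "'k list \<Rightarrow> 'k list" and v0 :: "'k list"
  assumes definable_group: "definable_group M n G"
    and topspace: "topspace \<tau> = carrier G"
    and continuous_mult: "continuous_map (prod_topology \<tau> \<tau>) \<tau> (\<lambda>(x, y). x \<otimes> y)"
    and open_V: "openin (Kn_top d) V"
    and v0: "v0 \<in> V" "\<phi> v0 = \<one>"
    and \<psi>_\<phi>: "v \<in> V \<Longrightarrow> \<psi> (\<phi> v) = v"
    and \<phi>_carrier: "v \<in> V \<Longrightarrow> \<phi> v \<in> carrier G"
    and open_map: "openin (Kn_top d) V' \<Longrightarrow> V' \<subseteq> V \<Longrightarrow> openin \<tau> (\<phi> ` V')"
    and filterlim_\<phi>: "filterlim \<phi> (nhdsin \<tau> \<one>) (nhds_Kn d v0)"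
    and mult_strict_gradient: "j < d \<Longrightarrow>
      \<exists>c. strict_gradient (d + d) (\<lambda>z. \<psi> (\<phi> (take d z) \<otimes> \<phi> (drop d z)) ! j) (v0 @ v0) c"
    and definable_\<phi>: "definable M (d + n) {v @ \<phi> v | v. v \<in> V}"

lemma strict_gradient_drop_nth:
  assumes "j < d'"
  shows "\<exists>c. strict_gradient (d + d') (\<lambda>z. drop d z ! j) a c"
proof (rule strict_gradient_cong_ex)
  show "\<exists>c. strict_gradient (d + d') (\<lambda>z. z ! (d + j)) a c"
    using assms strict_gradient_nth[of "d + j" "d + d'"] by auto
  show "\<forall>\<^sub>F z in nhds_Kn (d + d') a. z ! (d + j) = drop d z ! j"
    using eventually_in_Kn by eventually_elim (simp add: Kn_def)
qed

lemma strict_gradient_take_nth: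
  assumes "j < d"
  shows "\<exists>c. strict_gradient (d + d') (\<lambda>z. take d z ! j) a c"
  using assms strict_gradient_nth[of j "d + d'"] by auto

lemma filterlim_take_nhds_Kn:
  assumes "a \<in> Kn d" "b \<in> Kn d'"
  shows "filterlim (take d) (nhds_Kn d a) (nhds_Kn (d + d') (a @ b))"
proof -
  have "filterlim (take d) (nhds_Kn d (take d (a @ b))) (nhds_Kn (d + d') (a @ b))"
  proof (rule strict_gradient_filterlim)
    show "\<forall>\<^sub>F z in nhds_Kn (d + d') (a @ b). take d z \<in> Kn d"
      using eventually_in_Kn by eventually_elim (simp add: Kn_def)
  qed (use assms strict_gradient_take_nth in \<open>auto simp: Kn_def simp del: nth_take nth_drop\<close>)
  then show ?thesis using assms by (simp add: Kn_def)
qed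

lemma filterlim_drop_nhds_Kn:
  assumes "a \<in> Kn d" "b \<in> Kn d'"
  shows "filterlim (drop d) (nhds_Kn d' b) (nhds_Kn (d + d') (a @ b))"
proof -
  have "filterlim (drop d) (nhds_Kn d' (drop d (a @ b))) (nhds_Kn (d + d') (a @ b))"
  proof (rule strict_gradient_filterlim)
    show "\<forall>\<^sub>F z in nhds_Kn (d + d') (a @ b). drop d z \<in> Kn d'"
      using eventually_in_Kn by eventually_elim (simp add: Kn_def)
  qed (use assms strict_gradient_drop_nth in \<open>auto simp: Kn_def simp del: nth_take nth_drop\<close>)
  then show ?thesis using assms by (simp add: Kn_def)
qed

text \<open>\<phi> is the graph chart \<gamma> of the embedded manifold at the preimage of the
  identity, followed by the parametrization \<open>p\<close> from the atlas. In this chart the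
  product is a coordinate projection of \<open>h \<circ> u\<close>, where \<open>u\<close> applies
  \<gamma> to both halves and \<open>h\<close> is the local C^1 extension to ambient space provided
  by \<open>Ck_map\<close>; the chain rule applies to this composition.\<close>

lemma group_chart_exists:
  fixes M :: "('f, 'r, 'k::linordered_field) expansion"
    and G :: "('k list, 'm) monoid_scheme" (structure)
  assumes G: "definable_group M n G" and man: "Ck_group_manifold M 1 n G \<tau> A"
  shows "\<exists>d V \<phi> \<psi> v0. group_chart G M n \<tau> d V \<phi> \<psi> v0"
proof -
  interpret group G using G by (simp add: definable_group_def)
  have fin: "finitary_manifold M 1 n (carrier G) \<tau> A"
    and cmult: "continuous_map (prod_topology \<tau> \<tau>) \<tau> (\<lambda>(x, y). x \<otimes> y)"
    and Ckmult: "Ck_in_charts M 1 (prod_atlas A A) A (\<lambda>z. take n z \<otimes> drop n z)"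
    using man by (auto simp: Ck_group_manifold_def)
  have top: "topspace \<tau> = carrier G" and cover: "carrier G = (\<Union>c\<in>A. pimg c)"
    using fin by (auto simp: finitary_manifold_def)
  obtain d where emb: "\<And>c. c \<in> A \<Longrightarrow> embedded_manifold M 1 (pdim c) d (pdom c)"
    using fin unfolding finitary_manifold_def by blast
  have GK: "carrier G \<subseteq> Kn n"
    using G unfolding definable_group_def definable_def def_set_def by blast
  obtain c where c: "c \<in> A" and one: "\<one> \<in> pimg c" using cover one_closed by blast
  define N X p where "N = pdim c" and "X = pdom c" and "p = pmap c"
  have pmap: "definable_map M N n X p" and pimg: "openin \<tau> (p ` X)"
    and homeo: "homeomorphic_map (subtopology (Kn_top N) X) (subtopology \<tau> (p ` X)) p"
    using fin c unfolding finitary_manifold_def N_def X_def p_def by auto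
  have XK: "X \<subseteq> Kn N" and pK: "p ` X \<subseteq> Kn n" using pmap by (auto simp: definable_map_def)
  have defX: "definable M N X" using emb[OF c] by (simp add: embedded_manifold_def N_def X_def)
  have topX: "topspace (subtopology (Kn_top N) X) = X" using XK by auto
  have inj: "inj_on p X" using homeomorphic_imp_injective_map[OF homeo] topX by simp
  have pG: "p ` X \<subseteq> carrier G" using cover c by (auto simp: p_def X_def)
  define x0 where "x0 = inv_into X p \<one>"
  have x0: "x0 \<in> X" "p x0 = \<one>"
    using one by (auto simp: x0_def p_def X_def inv_into_into f_inv_into_f)
  have pinv: "inv_into X p (p x) = x" if "x \<in> X" for x using inj that by simp
  obtain U V \<sigma> \<gamma> where U: "open_box N U" "x0 \<in> U" and V: "open_box d V"
    and \<sigma>: "\<And>j. j < d \<Longrightarrow> \<sigma> j < N"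
    and \<gamma>1: "\<And>v. v \<in> V \<Longrightarrow> \<gamma> v \<in> X \<inter> U \<and> map (\<lambda>j. \<gamma> v ! \<sigma> j) [0..<d] = v"
    and \<gamma>2: "\<And>z. z \<in> X \<inter> U \<Longrightarrow> map (\<lambda>j. z ! \<sigma> j) [0..<d] \<in> V \<and> \<gamma> (map (\<lambda>j. z ! \<sigma> j) [0..<d]) = z"
    and \<gamma>3: "\<And>i a. i < N \<Longrightarrow> a \<in> V \<Longrightarrow> \<exists>c. strict_gradient d (\<lambda>v. \<gamma> v ! i) a c"
    using embedded_manifold_graph_chart[of M N d X x0] emb[OF c] x0(1)
    unfolding N_def X_def by blast
  define proj where "proj z = map (\<lambda>j. z ! \<sigma> j) [0..<d]" for z :: "'k list"
  define v0 where "v0 = proj x0"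
  define \<phi> where "\<phi> v = p (\<gamma> v)" for v
  define \<psi> where "\<psi> g = proj (inv_into X p g)" for g
  have openV: "openin (Kn_top d) V" by (rule openin_Kn_top_open_box[OF V])
  have VK: "V \<subseteq> Kn d" by (rule open_box_subset_Kn[OF V])
  have v0V: "v0 \<in> V" and \<gamma>v0: "\<gamma> v0 = x0" using \<gamma>2[of x0] x0 U by (auto simp: v0_def proj_def)
  have v0K: "v0 \<in> Kn d" using v0V VK by blast
  have \<gamma>X: "\<gamma> v \<in> X" "\<gamma> v \<in> U" "\<gamma> v \<in> Kn N" "proj (\<gamma> v) = v" if "v \<in> V" for v
    using \<gamma>1[OF that] XK by (auto simp: proj_def)
  have \<gamma>proj: "proj z \<in> V" "\<gamma> (proj z) = z" if "z \<in> X" "z \<in> U" for z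
    using \<gamma>2[of z] that by (auto simp: proj_def)
  have \<gamma>K: "\<forall>\<^sub>F v in nhds_Kn d v0. \<gamma> v \<in> Kn N"
    using eventually_in_openin[OF openV v0V] by eventually_elim (rule \<gamma>X)
  have oneT: "\<one> \<in> topspace \<tau>" by (simp add: top)

  have proj_lim: "filterlim proj (nhds_Kn d (proj z)) (nhds_Kn N z)" if "z \<in> Kn N" for z
  proof (rule strict_gradient_filterlim[OF that])
    show "\<exists>c. strict_gradient N (\<lambda>x. proj x ! j) z c" if "j < d" for j
      using that strict_gradient_nth[OF \<sigma>[OF that]] by (auto simp: proj_def)
  qed (simp add: proj_def Kn_def)

  have open_image: "openin \<tau> (\<phi> ` V')" if V': "openin (Kn_top d) V'" "V' \<subseteq> V" for V'
  proof -
    define O' where "O' = {z \<in> U. proj z \<in> V'}"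
    have "openin (Kn_top N) O'"
    proof (rule openin_eventually)
      show "O' \<subseteq> topspace (Kn_top N)" using open_box_subset_Kn[OF U(1)] by (auto simp: O'_def)
      fix z assume z: "z \<in> O'"
      then have "z \<in> Kn N" using open_box_subset_Kn[OF U(1)] by (auto simp: O'_def)
      have "\<forall>\<^sub>F x in nhds_Kn N z. proj x \<in> V'"
        using z by (intro filterlim_eventually_in_openin[OF proj_lim[OF \<open>z \<in> Kn N\<close>] V'(1)])
          (simp add: O'_def)
      moreover have "\<forall>\<^sub>F x in nhds_Kn N z. x \<in> U"
        using z by (intro eventually_in_openin openin_Kn_top_open_box U(1)) (simp add: O'_def)
      ultimately show "\<forall>\<^sub>F x in nhds_Kn N z. x \<in> O'"
        by eventually_elim (simp add: O'_def)
    qed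
    then have "openin (subtopology (Kn_top N) X) (X \<inter> O')"
      by (metis Int_commute openin_subtopology)
    then have "openin (subtopology \<tau> (p ` X)) (p ` (X \<inter> O'))"
      using homeomorphic_imp_open_map[OF homeo] by (simp add: open_map_def)
    then have "openin \<tau> (p ` (X \<inter> O'))"
      using pimg by (simp add: openin_open_subtopology)
    moreover have "p ` (X \<inter> O') = \<phi> ` V'"
    proof
      show "p ` (X \<inter> O') \<subseteq> \<phi> ` V'"
        using \<gamma>proj(2) by (force simp: O'_def \<phi>_def)
      show "\<phi> ` V' \<subseteq> p ` (X \<inter> O')"
        using \<gamma>X V'(2) by (auto simp: O'_def \<phi>_def subset_iff)
    qed
    ultimately show ?thesis by simp
  qed

  have lim_\<gamma>: "filterlim \<gamma> (nhds_Kn N x0) (nhds_Kn d v0)"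
    using strict_gradient_filterlim[OF v0K \<gamma>K \<gamma>3[OF _ v0V]] by (simp add: \<gamma>v0)
  have lim_\<phi>: "filterlim \<phi> (nhdsin \<tau> \<one>) (nhds_Kn d v0)"
  proof -
    have "\<forall>\<^sub>F v in nhds_Kn d v0. \<gamma> v \<in> X"
      using eventually_in_openin[OF openV v0V] by eventually_elim (rule \<gamma>X)
    then have "filterlim \<gamma> (nhdsin (subtopology (Kn_top N) X) x0) (nhds_Kn d v0)"
      using x0 XK by (intro filterlim_nhdsin_subtopology[OF lim_\<gamma>]) auto
    moreover have "filterlim p (nhdsin (subtopology \<tau> (p ` X)) (p x0)) (nhdsin (subtopology (Kn_top N) X) x0)"
      using x0 topX
      by (intro continuous_map_imp_filterlim_nhdsin homeomorphic_imp_continuous_map[OF homeo]) simp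
    moreover have "nhdsin (subtopology \<tau> (p ` X)) (p x0) = nhdsin \<tau> \<one>"
      using nhdsin_open_subtopology[OF pimg imageI[OF x0(1)]] x0(2) by simp
    ultimately show ?thesis unfolding \<phi>_def using filterlim_compose by fastforce
  qed

  let ?a = "v0 @ v0"
  have aK: "?a \<in> Kn (d + d)" using v0K by (simp add: Kn_def)
  have take_lim: "filterlim (take d) (nhds_Kn d v0) (nhds_Kn (d + d) ?a)"
    and drop_lim: "filterlim (drop d) (nhds_Kn d v0) (nhds_Kn (d + d) ?a)"
    using v0K by (auto intro: filterlim_take_nhds_Kn filterlim_drop_nhds_Kn)
  have takeV: "\<forall>\<^sub>F z in nhds_Kn (d + d) ?a. take d z \<in> V"
    and dropV: "\<forall>\<^sub>F z in nhds_Kn (d + d) ?a. drop d z \<in> V"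
    using filterlim_eventually_in_openin[OF _ openV v0V] take_lim drop_lim by auto
  define u where "u z = \<gamma> (take d z) @ \<gamma> (drop d z)" for z
  have ua: "u ?a = x0 @ x0" using v0K by (simp add: u_def \<gamma>v0 Kn_def)
  have uK: "\<forall>\<^sub>F z in nhds_Kn (d + d) ?a. u z \<in> Kn (N + N)"
    using takeV dropV by eventually_elim (use \<gamma>X(3) in \<open>auto simp: u_def Kn_def\<close>)
  have u_grad: "\<exists>c. strict_gradient (d + d) (\<lambda>z. u z ! i) ?a c" if i: "i < N + N" for i
  proof (cases "i < N")
    case True
    have "\<exists>c. strict_gradient (d + d) (\<lambda>z. \<gamma> (take d z) ! i) ?a c"
    proof (rule strict_gradient_compose_ex[OF aK, where u = "take d" and m = d])
      show "\<forall>\<^sub>F z in nhds_Kn (d + d) ?a. take d z \<in> Kn d"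
        using takeV by eventually_elim (use VK in blast)
      show "\<exists>c. strict_gradient d (\<lambda>v. \<gamma> v ! i) (take d ?a) c"
        using \<gamma>3[OF True v0V] v0K by (simp add: Kn_def)
    qed (rule strict_gradient_take_nth)
    then show ?thesis
    proof (rule strict_gradient_cong_ex)
      show "\<forall>\<^sub>F z in nhds_Kn (d + d) ?a. \<gamma> (take d z) ! i = u z ! i"
        using takeV by eventually_elim (use \<gamma>X(3) True in \<open>auto simp: u_def Kn_def nth_append\<close>)
    qed
  next
    case False
    then have iN: "i - N < N" using i by simp
    have "\<exists>c. strict_gradient (d + d) (\<lambda>z. \<gamma> (drop d z) ! (i - N)) ?a c"
    proof (rule strict_gradient_compose_ex[OF aK, where u = "drop d" and m = d])
      show "\<forall>\<^sub>F z in nhds_Kn (d + d) ?a. drop d z \<in> Kn d"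
        using dropV by eventually_elim (use VK in blast)
      show "\<exists>c. strict_gradient d (\<lambda>v. \<gamma> v ! (i - N)) (drop d ?a) c"
        using \<gamma>3[OF iN v0V] v0K by (simp add: Kn_def)
    qed (rule strict_gradient_drop_nth)
    then show ?thesis
    proof (rule strict_gradient_cong_ex)
      show "\<forall>\<^sub>F z in nhds_Kn (d + d) ?a. \<gamma> (drop d z) ! (i - N) = u z ! i"
        using takeV by eventually_elim (use \<gamma>X(3) False in \<open>auto simp: u_def Kn_def nth_append\<close>)
    qed
  qed

  let ?F = "\<lambda>z. take n z \<otimes> drop n z"
  \<comment> \<open>The domain on which the product, read in the charts
    \<open>prod_param c c\<close> and \<open>c\<close>, is given as a C^1 map.\<close>
  define B where "B = {z \<in> pdom (prod_param c c). ?F (pmap (prod_param c c) z) \<in> p ` X}"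
  have pp: "x @ y \<in> pdom (prod_param c c)" "?F (pmap (prod_param c c) (x @ y)) = p x \<otimes> p y"
    if "x \<in> X" "y \<in> X" for x y
  proof -
    show "x @ y \<in> pdom (prod_param c c)"
      using that by (auto simp: prod_param_def X_def)
    have "length x = N" "length (p x) = n" using that XK pK by (auto simp: Kn_def)
    then show "?F (pmap (prod_param c c) (x @ y)) = p x \<otimes> p y"
      by (simp add: prod_param_def N_def p_def)
  qed
  have "prod_param c c \<in> prod_atlas A A" using c by (auto simp: prod_atlas_def)
  then have "Ck_map M 1 (N + N) N B (\<lambda>z. inv_into X p (?F (pmap (prod_param c c) z)))"
    using Ckmult c unfolding Ck_in_charts_def B_def N_def X_def p_def
    by (auto simp: prod_param_def)
  moreover have "x0 @ x0 \<in> B"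
    using pp[OF x0(1) x0(1)] x0 by (auto simp: B_def image_iff intro!: bexI[of _ x0])
  ultimately obtain U2 h where U2: "open_box (N + N) U2" "x0 @ x0 \<in> U2"
    and h: "Ck_open 1 (N + N) N U2 h"
      "\<And>z. z \<in> B \<inter> U2 \<Longrightarrow> h z = inv_into X p (?F (pmap (prod_param c c) z))"
    unfolding Ck_map_def by metis
  have lim_u: "filterlim u (nhds_Kn (N + N) (x0 @ x0)) (nhds_Kn (d + d) ?a)"
    using strict_gradient_filterlim[OF aK uK u_grad] by (simp add: ua)
  have uU2: "\<forall>\<^sub>F z in nhds_Kn (d + d) ?a. u z \<in> U2"
    by (rule filterlim_eventually_in_openin[OF lim_u openin_Kn_top_open_box[OF U2(1)] U2(2)])
  have lim_prod: "filterlim (\<lambda>z. \<phi> (take d z) \<otimes> \<phi> (drop d z)) (nhdsin \<tau> \<one>) (nhds_Kn (d + d) ?a)"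
  proof -
    have "filterlim (\<lambda>z. (\<phi> (take d z), \<phi> (drop d z))) (nhdsin (prod_topology \<tau> \<tau>) (\<one>, \<one>)) (nhds_Kn (d + d) ?a)"
      using oneT by (intro filterlim_Pair_nhdsin filterlim_compose[OF lim_\<phi>] take_lim drop_lim)
    moreover have "filterlim (\<lambda>(x, y). x \<otimes> y) (nhdsin \<tau> \<one>) (nhdsin (prod_topology \<tau> \<tau>) (\<one>, \<one>))"
      using continuous_map_imp_filterlim_nhdsin[OF cmult, of "(\<one>, \<one>)"] oneT by simp
    ultimately show ?thesis using filterlim_compose by fastforce
  qed
  \<comment> \<open>Products of elements near the identity remain in the image of the same chart, so
    \<open>u z\<close> lies in \<open>B\<close> for \<open>z\<close> near the base point and
    \<open>h (u z)\<close> is the product in coordinates.\<close>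
  have prod_img: "\<forall>\<^sub>F z in nhds_Kn (d + d) ?a. \<phi> (take d z) \<otimes> \<phi> (drop d z) \<in> p ` X"
    using x0 by (intro filterlim_eventually_in_openin[OF lim_prod pimg]) (auto intro: image_eqI[of _ _ x0])

  have grad: "\<exists>c. strict_gradient (d + d) (\<lambda>z. \<psi> (\<phi> (take d z) \<otimes> \<phi> (drop d z)) ! j) ?a c"
    if j: "j < d" for j
  proof (rule strict_gradient_cong_ex)
    show "\<exists>c. strict_gradient (d + d) (\<lambda>z. h (u z) ! \<sigma> j) ?a c"
    proof (rule strict_gradient_compose_ex[OF aK uK u_grad])
      have "Ck_scalar (N + N) (Suc 0) U2 (\<lambda>x. h x ! \<sigma> j)"
        using h(1) \<sigma>[OF j] unfolding Ck_open_def by simp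
      then show "\<exists>b. strict_gradient (N + N) (\<lambda>x. h x ! \<sigma> j) (u ?a) b"
        using U2(2) unfolding ua by (intro strict_gradient_C1[OF openin_Kn_top_open_box[OF U2(1)]])
    qed
    show "\<forall>\<^sub>F z in nhds_Kn (d + d) ?a. h (u z) ! \<sigma> j = \<psi> (\<phi> (take d z) \<otimes> \<phi> (drop d z)) ! j"
      using takeV dropV uU2 prod_img
    proof eventually_elim
      case (elim z)
      note X = \<gamma>X(1)[OF elim(1)] \<gamma>X(1)[OF elim(2)]
      have "u z \<in> B" using pp[OF X] elim(4) by (simp add: B_def u_def \<phi>_def)
      then have "h (u z) = inv_into X p (\<phi> (take d z) \<otimes> \<phi> (drop d z))"
        using h(2)[of "u z"] elim(3) pp(2)[OF X] by (simp add: u_def \<phi>_def)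
      then show ?case using j by (simp add: \<psi>_def proj_def)
    qed
  qed

  have "definable M (d + n) {v @ \<phi> v | v. v \<in> V}"
  proof (rule definable_if_definable_pred)
    \<comment> \<open>The function whose graph describes \<open>X\<close> near \<open>x0\<close> is
      not postulated to be definable. The formula avoids it: \<gamma> w is the unique point
      \<open>z\<close> of \<open>X \<inter> U\<close> with projection \<open>w\<close>.\<close>
    have "definable_pred M (\<lambda>e. \<exists>z\<in>Kn N. (z \<in> X \<and> z \<in> U) \<and> (\<forall>j<d. z ! \<sigma> j = e j) \<and>
        z @ map (\<lambda>i. e (i + d)) [0..<n] \<in> {x @ p x | x. x \<in> X})"
    proof (rule definable_pred_ex_list, intro definable_pred_conj definable_pred_all_less)
      show "definable_pred M (\<lambda>e. map e [0..<N] \<in> X)" "definable_pred M (\<lambda>e. map e [0..<N] \<in> U)"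
        by (intro definable_pred_mem[OF defX] definable_pred_mem[OF definable_open_box[OF U(1)]]
            atomic_list_coords'; simp)+
      show "definable_pred M (\<lambda>e. map e [0..<N] ! \<sigma> j = e (j + N))" if "j < d" for j
        using \<sigma>[OF that] by (auto intro: definable_pred_atomic_eq)
      show "definable_pred M (\<lambda>e. map e [0..<N] @ map (\<lambda>i. e (i + d + N)) [0..<n] \<in> {x @ p x | x. x \<in> X})"
        using pmap unfolding definable_map_def
        by (intro definable_pred_mem[of M "N + n"] atomic_list_append atomic_list_coords atomic_list_coords') auto
    qed
    moreover have "map e [0..<d + n] \<in> {v @ \<phi> v | v. v \<in> V} \<longleftrightarrow>
        (\<exists>z\<in>Kn N. (z \<in> X \<and> z \<in> U) \<and> (\<forall>j<d. z ! \<sigma> j = e j) \<and>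
        z @ map (\<lambda>i. e (i + d)) [0..<n] \<in> {x @ p x | x. x \<in> X})" for e :: "nat \<Rightarrow> 'k"
    proof -
      define w g where "w = map e [0..<d]" and "g = map (\<lambda>i. e (i + d)) [0..<n]"
      have e: "map e [0..<d + n] = w @ g"
        unfolding w_def g_def by (rule nth_equalityI) (auto simp: nth_append)
      have 1: "w @ g \<in> {v @ \<phi> v | v. v \<in> V} \<longleftrightarrow> w \<in> V \<and> g = \<phi> w"
        using VK by (auto simp: w_def Kn_def subset_iff append_eq_append_conv)
      have 2: "z @ g \<in> {x @ p x | x. x \<in> X} \<longleftrightarrow> g = p z" if "z \<in> X" for z
        using that XK by (auto simp: Kn_def subset_iff append_eq_append_conv)
      have 3: "(\<forall>j<d. z ! \<sigma> j = e j) \<longleftrightarrow> proj z = w" for z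
        by (auto simp: proj_def w_def list_eq_iff_nth_eq)
      have "w \<in> V \<and> g = \<phi> w \<longleftrightarrow> (\<exists>z\<in>Kn N. (z \<in> X \<and> z \<in> U) \<and> proj z = w \<and> g = p z)"
      proof
        assume "w \<in> V \<and> g = \<phi> w"
        then show "\<exists>z\<in>Kn N. (z \<in> X \<and> z \<in> U) \<and> proj z = w \<and> g = p z"
          by (intro bexI[of _ "\<gamma> w"]) (simp_all add: \<gamma>X \<phi>_def)
      next
        assume "\<exists>z\<in>Kn N. (z \<in> X \<and> z \<in> U) \<and> proj z = w \<and> g = p z"
        then show "w \<in> V \<and> g = \<phi> w"
          using \<gamma>proj by (auto simp: \<phi>_def)
      qed
      then show ?thesis unfolding e 1 3 g_def[symmetric] using 2 by (auto cong: conj_cong)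
    qed
    ultimately show "definable_pred M (\<lambda>e. map e [0..<d + n] \<in> {v @ \<phi> v | v. v \<in> V})"
      by (simp only:)
    show "{v @ \<phi> v | v. v \<in> V} \<subseteq> Kn (d + n)"
      using VK \<gamma>X(1) pK by (auto simp: \<phi>_def Kn_def subset_iff image_subset_iff)
  qed
  moreover have "\<phi> v \<in> carrier G" if "v \<in> V" for v
    using \<gamma>X(1)[OF that] pG by (auto simp: \<phi>_def)
  moreover have "\<psi> (\<phi> v) = v" if "v \<in> V" for v
    using \<gamma>X[OF that] pinv by (simp add: \<psi>_def \<phi>_def)
  moreover have "\<phi> v0 = \<one>" using x0 by (simp add: \<phi>_def \<gamma>v0)
  ultimately have "group_chart G M n \<tau> d V \<phi> \<psi> v0"
    by (unfold_locales) (use G top cmult openV v0V open_image lim_\<phi> grad in auto)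
  then show ?thesis by blast
qed

section \<open>Local surjectivity\<close>

lemma l1_dist_snoc:
  assumes "x \<in> Kn d" "y \<in> Kn d"
  shows "l1_dist (Suc d) (x @ [s]) (y @ [t]) = l1_dist d x y + \<bar>s - t\<bar>"
proof -
  have "l1_dist d (x @ [s]) (y @ [t]) = l1_dist d x y"
    unfolding l1_dist_def using assms by (intro sum.cong) (auto simp: nth_append Kn_def)
  then show ?thesis using assms by (simp add: l1_dist_def nth_append Kn_def)
qed

lemma Kn_Suc_snocE:
  assumes "x \<in> Kn (Suc n)"
  obtains y a where "x = y @ [a]" "y \<in> Kn n"
  using assms by (cases x rule: rev_cases) (auto simp: Kn_def)

text \<open>The distance from \<open>p x\<close> to \<open>y\<close> is minimised over the closed
  ball of radius \<open>r\<close> about \<open>v0\<close>. To make it a coordinate, one passes to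
  its epigraph, cut off at height \<open>r\<close> to stay bounded. Definability is asked for r <
  \<rho>0 only, since the intended \<open>p\<close> is controlled on a small ball alone.\<close>

lemma strict_gradient_locally_surj:
  fixes p :: "'k::linordered_field list \<Rightarrow> 'k list"
  assumes M: "definably_complete M" and m: "0 < m" and v0: "v0 \<in> Kn d" "p v0 = v0"
    and pK: "\<forall>\<^sub>F x in nhds_Kn d v0. p x \<in> Kn d"
    and grad: "\<And>j. j < d \<Longrightarrow> strict_gradient d (\<lambda>x. p x ! j) v0 (\<lambda>i. if i = j then of_nat m else 0)"
    and "0 < \<rho>0" and def: "\<And>r y. 0 < r \<Longrightarrow> r < \<rho>0 \<Longrightarrow> y \<in> Kn d \<Longrightarrow>
      definable M (Suc d) {x @ [s] | x s. x \<in> Kn d \<and> l1_dist d x v0 \<le> r \<and> l1_dist d (p x) y \<le> s \<and> s \<le> r}"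
  shows "\<forall>\<^sub>F y in nhds_Kn d v0. \<exists>x\<in>Kn d. l1_dist d x v0 < \<rho>0 \<and> p x = y"
proof -
  \<comment> \<open>The l1 error of approximating \<open>p y - p x\<close> by m times
    \<open>y - x\<close>.\<close>
  define D where "D x y = (\<Sum>j<d. \<bar>p y ! j - p x ! j - of_nat m * (y ! j - x ! j)\<bar>)" for x y
  obtain K where K: "K > 0"
      "\<forall>\<^sub>F x in nhds_Kn d v0. \<forall>\<^sub>F y in nhds_Kn d x. l1_dist d (p y) (p x) \<le> K * l1_dist d y x"
    using strict_gradient_lipschitz[of d d p v0 "\<lambda>j i. if i = j then of_nat m else 0", OF grad] by blast
  have "of_nat 1 \<le> (of_nat m :: 'k)" using m by (intro of_nat_mono) simp
  then have m1: "(1::'k) \<le> of_nat m" by simp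
  \<comment> \<open>The errors of d components then add up to at most half of the distance.\<close>
  define \<epsilon> :: 'k where "\<epsilon> = 1 / (2 * of_nat (Suc d))"
  have \<epsilon>: "0 < \<epsilon>" by (simp add: \<epsilon>_def del: of_nat_Suc)
  have "\<forall>\<^sub>F x in nhds_Kn d v0. \<forall>\<^sub>F y in nhds_Kn d x. \<forall>j<d.
      \<bar>p y ! j - p x ! j - (\<Sum>i<d. (if i = j then of_nat m else 0) * (y ! i - x ! i))\<bar>
        \<le> \<epsilon> * l1_dist d y x"
    by (intro strict_gradient_uniform grad \<epsilon>)
  then have D: "\<forall>\<^sub>F x in nhds_Kn d v0. \<forall>\<^sub>F y in nhds_Kn d x. D x y \<le> 1 / 2 * l1_dist d y x"
  proof (elim eventually_mono)
    fix x y :: "'k list"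
    assume *: "\<forall>j<d. \<bar>p y ! j - p x ! j - (\<Sum>i<d. (if i = j then of_nat m else 0) * (y ! i - x ! i))\<bar>
        \<le> \<epsilon> * l1_dist d y x"
    have "(\<Sum>i<d. (if i = j then of_nat m else 0) * (y ! i - x ! i)) = of_nat m * (y ! j - x ! j)"
      if "j < d" for j
      using that by (simp add: if_distrib[of "\<lambda>c. c * _"] cong: if_cong)
    then have "D x y \<le> (\<Sum>j<d. \<epsilon> * l1_dist d y x)"
      unfolding D_def using * by (intro sum_mono) auto
    also have "\<dots> = (of_nat d * \<epsilon>) * l1_dist d y x" by simp
    also have "\<dots> \<le> 1 / 2 * l1_dist d y x"
    proof (rule mult_right_mono)
      have "of_nat d * \<epsilon> \<le> of_nat (Suc d) * \<epsilon>" using \<epsilon> by (intro mult_right_mono) auto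
      also have "\<dots> = 1 / 2" by (simp add: \<epsilon>_def del: of_nat_Suc)
      finally show "of_nat d * \<epsilon> \<le> 1 / 2" .
    qed simp
    finally show "D x y \<le> 1 / 2 * l1_dist d y x" .
  qed
  \<comment> \<open>The nested condition \<open>D\<close> is also valid with \<open>v0\<close>
    itself as base point; this later keeps the minimiser off the boundary.\<close>
  have "\<forall>\<^sub>F x in nhds_Kn d v0. D v0 x \<le> 1 / 2 * l1_dist d x v0"
    by (rule eventually_nhdsin_self[OF D]) (simp add: v0)
  with D K(2) pK have "\<forall>\<^sub>F x in nhds_Kn d v0.
      (\<forall>\<^sub>F y in nhds_Kn d x. D x y \<le> 1 / 2 * l1_dist d y x) \<and>
      (\<forall>\<^sub>F y in nhds_Kn d x. l1_dist d (p y) (p x) \<le> K * l1_dist d y x) \<and>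
      p x \<in> Kn d \<and> D v0 x \<le> 1 / 2 * l1_dist d x v0"
    by (intro eventually_conj)
  then obtain \<rho> where "0 < \<rho>" and \<rho>:
      "\<And>x. x \<in> Kn d \<Longrightarrow> l1_dist d x v0 < \<rho> \<Longrightarrow> \<forall>\<^sub>F y in nhds_Kn d x. D x y \<le> 1 / 2 * l1_dist d y x"
      "\<And>x. x \<in> Kn d \<Longrightarrow> l1_dist d x v0 < \<rho> \<Longrightarrow> \<forall>\<^sub>F y in nhds_Kn d x. l1_dist d (p y) (p x) \<le> K * l1_dist d y x"
      "\<And>x. x \<in> Kn d \<Longrightarrow> l1_dist d x v0 < \<rho> \<Longrightarrow> p x \<in> Kn d"
      "\<And>x. x \<in> Kn d \<Longrightarrow> l1_dist d x v0 < \<rho> \<Longrightarrow> D v0 x \<le> 1 / 2 * l1_dist d x v0"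
    unfolding eventually_nhds_Kn[OF v0(1)] by blast
  define r where "r = min \<rho> \<rho>0 / 2"
  have r: "0 < r" "r < \<rho>" "r < \<rho>0" using \<open>0 < \<rho>\<close> \<open>0 < \<rho>0\<close> by (auto simp: r_def min_def)
  have "\<exists>x\<in>Kn d. l1_dist d x v0 < \<rho>0 \<and> p x = y" if y: "y \<in> Kn d" "l1_dist d y v0 < r / 4" for y
  proof -
    define C where "C = {x @ [s] | x s. x \<in> Kn d \<and> l1_dist d x v0 \<le> r \<and> l1_dist d (p x) y \<le> s \<and> s \<le> r}"
    have C: "x @ [s] \<in> C \<longleftrightarrow> x \<in> Kn d \<and> l1_dist d x v0 \<le> r \<and> l1_dist d (p x) y \<le> s \<and> s \<le> r" for x s
      by (auto simp: C_def)
    have CK: "C \<subseteq> Kn (Suc d)" by (auto simp: C_def Kn_def)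
    have pv0: "l1_dist d (p v0) y < r / 4" using y(2) by (simp add: v0(2) l1_dist_commute)
    have "\<exists>x\<in>C. \<forall>z\<in>C. x ! d \<le> z ! d"
    proof (rule definable_attains_min_last[OF M])
      show "definable M (Suc d) C" unfolding C_def by (rule def[OF r(1,3) y(1)])
      have "v0 @ [r] \<in> C" using r pv0 v0 by (simp add: C)
      then show "C \<noteq> {}" by blast
      show "\<bar>z ! i\<bar> \<le> (\<Sum>i<d. \<bar>v0 ! i\<bar>) + r" if "z \<in> C" "i \<le> d" for z i
      proof -
        from \<open>z \<in> C\<close> obtain x s where z: "z = x @ [s]" "x \<in> Kn d" "l1_dist d x v0 \<le> r"
            "l1_dist d (p x) y \<le> s" "s \<le> r"
          unfolding C_def by blast
        show ?thesis
        proof (cases "i < d")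
          case True
          then have "\<bar>v0 ! i\<bar> \<le> (\<Sum>i<d. \<bar>v0 ! i\<bar>)" by (rule abs_le_sum_abs)
          moreover have "\<bar>x ! i - v0 ! i\<bar> \<le> r" using abs_nth_le_l1_dist[OF True, of x v0] z(3) by simp
          moreover have "z ! i = x ! i" using z(1,2) True by (simp add: nth_append Kn_def)
          ultimately show ?thesis by linarith
        next
          case False
          then have "z ! i = s" using z(1,2) \<open>i \<le> d\<close> by (simp add: nth_append Kn_def)
          moreover have "0 \<le> s" using z(4) l1_dist_nonneg[of d "p x" y] by linarith
          moreover have "0 \<le> (\<Sum>i<d. \<bar>v0 ! i\<bar>)" by (rule sum_nonneg) simp
          ultimately show ?thesis using z(5) by linarith
        qed
      qed
      show "closedin (Kn_top (Suc d)) C"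
        unfolding closedin_Kn_top_iff
      proof (intro conjI ballI impI CK)
        fix z assume "z \<in> Kn (Suc d)" and *: "\<forall>\<epsilon>>0. \<exists>x\<in>C. l1_dist (Suc d) x z < \<epsilon>"
        then obtain x s where z: "z = x @ [s]" "x \<in> Kn d" by (blast elim: Kn_Suc_snocE)
        have near: "\<exists>x' s'. x' @ [s'] \<in> C \<and> l1_dist d x' x < \<epsilon> \<and> \<bar>s' - s\<bar> < \<epsilon>" if \<epsilon>: "0 < \<epsilon>" for \<epsilon>
        proof -
          obtain w where w: "w \<in> C" "l1_dist (Suc d) w z < \<epsilon>" using * \<epsilon> by blast
          then obtain x' s' where x': "w = x' @ [s']" "x' \<in> Kn d" using CK by (blast elim: Kn_Suc_snocE)
          have "l1_dist d x' x + \<bar>s' - s\<bar> < \<epsilon>" using w(2) x' z by (simp add: l1_dist_snoc)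
          then have "l1_dist d x' x < \<epsilon>" "\<bar>s' - s\<bar> < \<epsilon>"
            using l1_dist_nonneg[of d x' x] by linarith+
          then show ?thesis using w(1) x'(1) by blast
        qed
        have xr: "l1_dist d x v0 \<le> r"
        proof (rule ccontr)
          assume "\<not> ?thesis"
          then obtain x' s' where "x' @ [s'] \<in> C" "l1_dist d x' x < l1_dist d x v0 - r"
            using near[of "l1_dist d x v0 - r"] by auto
          then show False
            using l1_dist_triangle[of d x v0 x'] l1_dist_commute[of d x' x] C[of x' s'] by linarith
        qed
        have sr: "s \<le> r"
        proof (rule ccontr)
          assume "\<not> ?thesis"
          then obtain x' s' where "x' @ [s'] \<in> C" "\<bar>s' - s\<bar> < s - r" using near[of "s - r"] by auto
          then show False using C[of x' s'] by linarith
        qed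
        have "l1_dist d (p x) y \<le> s"
        proof (rule ccontr)
          assume "\<not> ?thesis"
          define \<eta> where "\<eta> = l1_dist d (p x) y - s"
          have \<eta>: "0 < \<eta>" using \<open>\<not> l1_dist d (p x) y \<le> s\<close> by (simp add: \<eta>_def)
          obtain \<rho>' where "0 < \<rho>'" and \<rho>': "\<And>x'. x' \<in> Kn d \<Longrightarrow> l1_dist d x' x < \<rho>' \<Longrightarrow>
              l1_dist d (p x') (p x) \<le> K * l1_dist d x' x"
            using \<rho>(2)[OF z(2)] xr r(2) unfolding eventually_nhds_Kn[OF z(2)] by fastforce
          \<comment> \<open>Moving from x' to x costs at most K e in the image and e in the last
            coordinate, together at most \<eta> / 2.\<close>
          define e where "e = min \<rho>' (\<eta> / (2 * (K + 1)))"
          have "0 < e" using \<open>0 < \<rho>'\<close> \<eta> K(1) by (auto simp: e_def intro!: divide_pos_pos add_pos_pos)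
          then obtain x' s' where x': "x' @ [s'] \<in> C" "l1_dist d x' x < e" "\<bar>s' - s\<bar> < e"
            using near by blast
          then have "l1_dist d (p x') (p x) \<le> K * l1_dist d x' x"
            using C[of x' s'] by (intro \<rho>') (auto simp: e_def)
          also have "\<dots> \<le> K * e" using x'(2) K(1) by simp
          finally have "l1_dist d (p x) y \<le> K * e + s'"
            using l1_dist_triangle[of d "p x" y "p x'"] C[of x' s'] x'(1) l1_dist_commute[of d "p x'" "p x"]
            by linarith
          then have "\<eta> < K * e + e" using x'(3) unfolding \<eta>_def by linarith
          also have "\<dots> = (K + 1) * e" by (simp add: algebra_simps)
          also have "\<dots> \<le> (K + 1) * (\<eta> / (2 * (K + 1)))"
            using K(1) by (intro mult_left_mono) (auto simp: e_def)
          also have "\<dots> = \<eta> / 2" using K(1) by (simp add: field_simps)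
          finally show False using \<eta> by linarith
        qed
        then show "z \<in> C" using xr sr z by (simp add: C)
      qed
    qed
    then obtain x s where xC: "x @ [s] \<in> C" and min: "\<And>z. z \<in> C \<Longrightarrow> (x @ [s]) ! d \<le> z ! d"
      unfolding C_def by blast
    have x: "x \<in> Kn d" "l1_dist d x v0 \<le> r" "l1_dist d (p x) y \<le> s" "s \<le> r"
      using xC by (auto simp: C)
    \<comment> \<open>Points cut off by the height \<open>r\<close> do no harm: their distance
      exceeds \<open>r\<close>, while that of the minimiser is at most s \<le> r.\<close>
    have x_min: "l1_dist d (p x) y \<le> l1_dist d (p x') y" if "x' \<in> Kn d" "l1_dist d x' v0 \<le> r" for x'
    proof (cases "l1_dist d (p x') y \<le> r")
      case True
      then have "x' @ [l1_dist d (p x') y] \<in> C" using that by (simp add: C)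
      from min[OF this] show ?thesis using x(1,3) that(1) by (simp add: nth_append Kn_def)
    qed (use x in linarith)
    have "l1_dist d (p x) y < r / 4" using x_min[OF v0(1)] pv0 r by simp
    \<comment> \<open>The minimiser is interior. With \<bar>.\<bar> for the l1 norm, \<bar>x -
      v0\<bar> \<le> m \<bar>x - v0\<bar> \<le> \<bar>x - v0\<bar> / 2 + \<bar>p x - v0\<bar>. Here
      p x is within r / 4 of y, because already p v0 is, and y is within r / 4 of v0; hence \<bar>x
      - v0\<bar> < r.\<close>
    moreover have "of_nat m * l1_dist d x v0 \<le> D v0 x + l1_dist d (p x) v0"
    proof -
      have "of_nat m * l1_dist d x v0 = (\<Sum>j<d. \<bar>of_nat m * (x ! j - v0 ! j)\<bar>)"
        by (simp add: l1_dist_def sum_distrib_left abs_mult)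
      also have "\<dots> \<le> D v0 x + l1_dist d (p x) v0"
        unfolding D_def l1_dist_def sum.distrib[symmetric] v0(2) by (rule sum_mono) linarith
      finally show ?thesis .
    qed
    moreover have "D v0 x \<le> 1 / 2 * l1_dist d x v0" using x r by (intro \<rho>(4)) auto
    moreover have "l1_dist d x v0 \<le> of_nat m * l1_dist d x v0"
      using mult_right_mono[OF m1, of "l1_dist d x v0"] by simp
    ultimately have xr: "l1_dist d x v0 < r"
      using l1_dist_triangle[of d "p x" v0 y] y(2) by linarith
    have pxK: "p x \<in> Kn d" using x r by (intro \<rho>(3)) auto
    have "l1_dist d (p x) y = 0"
    proof (rule ccontr)
      let ?q = "l1_dist d (p x) y"
      assume "?q \<noteq> 0"
      then have q: "0 < ?q" using l1_dist_nonneg[of d "p x" y] by linarith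
      obtain \<rho>' where "0 < \<rho>'" and \<rho>': "\<And>x'. x' \<in> Kn d \<Longrightarrow> l1_dist d x' x < \<rho>' \<Longrightarrow>
          D x x' \<le> 1 / 2 * l1_dist d x' x"
        using \<rho>(1)[OF x(1)] x(2) r(2) unfolding eventually_nhds_Kn[OF x(1)] by fastforce
      \<comment> \<open>A step length that makes 1 - t m nonnegative, keeps x' where the
        approximation at \<open>x\<close> is valid, and keeps x' in the ball of radius
        \<open>r\<close>.\<close>
      define t where "t = min (1 / of_nat m) (min (\<rho>' / 2) (r - l1_dist d x v0) / ?q)"
      have t: "0 < t" using m1 q \<open>0 < \<rho>'\<close> xr by (auto simp: t_def)
      have "t * of_nat m \<le> 1 / of_nat m * of_nat m" using m1 by (intro mult_right_mono) (auto simp: t_def)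
      then have tm: "t * of_nat m \<le> 1" using m by simp
      have "t * ?q \<le> min (\<rho>' / 2) (r - l1_dist d x v0) / ?q * ?q"
        using q by (intro mult_right_mono) (auto simp: t_def)
      then have tq: "t * ?q \<le> \<rho>' / 2" "t * ?q \<le> r - l1_dist d x v0" using q by auto
      define x' where "x' = map (\<lambda>j. x ! j - t * (p x ! j - y ! j)) [0..<d]"
      have x'K: "x' \<in> Kn d" by (simp add: x'_def Kn_def)
      have x'x: "l1_dist d x' x = t * ?q"
        using t by (simp add: l1_dist_def x'_def sum_distrib_left abs_mult abs_minus_commute)
      have "l1_dist d x' v0 \<le> r" using l1_dist_triangle[of d x' v0 x] x'x tq(2) by linarith
      then have "?q \<le> l1_dist d (p x') y" by (rule x_min[OF x'K])
      \<comment> \<open>The linear part of the step shrinks p x - y by the factor 1 - t m, and D x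
        x' is at most t q / 2. Minimality then forces t q m \<le> t q / 2, which is impossible for m
        \<ge> 1.\<close>
      also have "\<dots> \<le> D x x' + (1 - t * of_nat m) * ?q"
      proof -
        have "(1 - t * of_nat m) * ?q = (\<Sum>j<d. \<bar>(1 - t * of_nat m) * (p x ! j - y ! j)\<bar>)"
          using tm by (simp add: l1_dist_def sum_distrib_left abs_mult)
        moreover have "\<bar>p x' ! j - y ! j\<bar> \<le> \<bar>p x' ! j - p x ! j - of_nat m * (x' ! j - x ! j)\<bar> +
            \<bar>(1 - t * of_nat m) * (p x ! j - y ! j)\<bar>" if "j < d" for j
        proof -
          have "p x' ! j - y ! j = (p x' ! j - p x ! j - of_nat m * (x' ! j - x ! j)) +
              (1 - t * of_nat m) * (p x ! j - y ! j)"
            using that by (simp add: x'_def algebra_simps)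
          then show ?thesis by (metis abs_triangle_ineq)
        qed
        ultimately show ?thesis
          unfolding D_def l1_dist_def[of d "p x'" y] by (auto simp: sum.distrib[symmetric] intro!: sum_mono)
      qed
      also have "\<dots> \<le> 1 / 2 * (t * ?q) + (1 - t * of_nat m) * ?q"
        using \<rho>'[OF x'K] x'x tq(1) \<open>0 < \<rho>'\<close> by simp
      finally have "t * ?q * of_nat m \<le> 1 / 2 * (t * ?q)" by (simp add: algebra_simps)
      moreover have "t * ?q \<le> t * ?q * of_nat m" using mult_left_mono[OF m1, of "t * ?q"] t q by simp
      moreover have "0 < t * ?q" using t q by simp
      ultimately show False by linarith
    qed
    then have "p x = y" by (rule l1_dist_eq_0D[OF pxK y(1)])
    then show ?thesis using x(1) xr r(3) by (intro bexI[of _ x]) auto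
  qed
  moreover have "0 < r / 4" using r(1) by simp
  ultimately show ?thesis unfolding eventually_nhds_Kn[OF v0(1)] by blast
qed

section \<open>Power maps\<close>

lemma strict_gradient_coeff_cong:
  assumes "strict_gradient n g a c" "\<And>i. i < n \<Longrightarrow> c i = c' i"
  shows "strict_gradient n g a c'"
proof -
  have "(\<Sum>i<n. c i * (y ! i - x ! i)) = (\<Sum>i<n. c' i * (y ! i - x ! i))" for x y :: "'a list"
    using assms(2) by (intro sum.cong) auto
  then show ?thesis using assms(1) by (simp add: strict_gradient_def)
qed

context group_chart
begin

lemma carrier_subset_Kn: "carrier G \<subseteq> Kn n"
  using definable_group unfolding definable_group_def definable_def def_set_def by blast

lemma V_subset_Kn: "V \<subseteq> Kn d"
  using openin_subset[OF open_V] by simp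

lemma v0_Kn: "v0 \<in> Kn d"
  using v0(1) V_subset_Kn by blast

lemma eventually_V: "\<forall>\<^sub>F v in nhds_Kn d v0. v \<in> V"
  by (rule eventually_in_openin[OF open_V v0(1)])

lemma continuous_map_pow: "continuous_map \<tau> \<tau> (\<lambda>x. x [^] (m::nat))"
proof (induction m)
  case 0
  have "continuous_map \<tau> \<tau> (\<lambda>x. \<one>)" using topspace by (auto intro: continuous_map_const[THEN iffD2])
  then show ?case by simp
next
  case (Suc m)
  have "continuous_map \<tau> (prod_topology \<tau> \<tau>) (\<lambda>x. (x [^] m, x))"
    using Suc by (intro continuous_map_pairedI continuous_map_id[unfolded id_def])
  from continuous_map_compose[OF this continuous_mult] show ?case by (simp add: o_def)
qed

lemma continuous_map_left_mult:
  assumes "a \<in> carrier G"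
  shows "continuous_map \<tau> \<tau> (\<lambda>x. a \<otimes> x)"
proof -
  have "continuous_map \<tau> (prod_topology \<tau> \<tau>) (\<lambda>x. (a, x))"
    using assms topspace by (intro continuous_map_pairedI continuous_map_id[unfolded id_def]) auto
  from continuous_map_compose[OF this continuous_mult] show ?thesis by (simp add: o_def)
qed

lemma openin_left_translate:
  assumes "openin \<tau> S" "a \<in> carrier G"
  shows "openin \<tau> ((\<lambda>x. a \<otimes> x) ` S)"
proof -
  have S: "S \<subseteq> carrier G" using openin_subset[OF assms(1)] topspace by simp
  have "openin \<tau> {x \<in> topspace \<tau>. inv a \<otimes> x \<in> S}"
    by (rule openin_continuous_map_preimage[OF continuous_map_left_mult assms(1)]) (simp add: assms)
  moreover have "{x \<in> topspace \<tau>. inv a \<otimes> x \<in> S} = (\<lambda>x. a \<otimes> x) ` S"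
  proof (intro equalityI subsetI)
    fix x assume "x \<in> {x \<in> topspace \<tau>. inv a \<otimes> x \<in> S}"
    then show "x \<in> (\<lambda>x. a \<otimes> x) ` S"
      using assms topspace by (intro image_eqI[of _ _ "inv a \<otimes> x"]) (auto simp: m_assoc[symmetric])
  qed (use assms S topspace in \<open>auto simp: m_assoc[symmetric] subset_iff\<close>)
  ultimately show ?thesis by simp
qed

text \<open>By recursion on m, each multiplication is expressed through its graph, with a quantifier
  over the previous power. Membership of the base in the carrier belongs to the predicate because
  the graph of multiplication covers elements of the carrier only.\<close>

lemma definable_pred_pow:
  assumes "atomic_list n f" "atomic_list n g"
  shows "definable_pred M (\<lambda>e. f e \<in> carrier G \<and> g e = f e [^] (m::nat))"
  using assms
proof (induction m arbitrary: f g)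
  case 0
  have "definable M n (carrier G)" using definable_group by (simp add: definable_group_def)
  \<comment> \<open>The coordinates of the identity enter as n parameters.\<close>
  then have "definable_pred M (\<lambda>e. f e \<in> carrier G \<and> (\<forall>i<n. g e ! i = \<one> ! i))"
    using 0 by (intro definable_pred_conj definable_pred_mem[of M n] definable_pred_all_less
        definable_pred_atomic_eq) (auto simp: atomic_list_def)
  moreover have "(\<forall>i<n. g e ! i = \<one> ! i) \<longleftrightarrow> g e = \<one>" for e
    using 0(2) carrier_subset_Kn one_closed
    by (auto simp: atomic_list_def Kn_def list_eq_iff_nth_eq subset_iff)
  ultimately show ?case by simp
next
  case (Suc m)
  let ?\<Gamma> = "{x @ y @ (x \<otimes> y) | x y. x \<in> carrier G \<and> y \<in> carrier G}"
  have \<Gamma>: "definable M (n + (n + n)) ?\<Gamma>"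
  proof -
    have "n + (n + n) = 3 * n" by simp
    then show ?thesis using definable_group by (simp only: definable_group_def)
  qed
  have "definable_pred M (\<lambda>e. \<exists>z\<in>Kn n. (f e \<in> carrier G \<and> z = f e [^] m) \<and> z @ f e @ g e \<in> ?\<Gamma>)"
    by (intro definable_pred_ex_list definable_pred_conj Suc.IH definable_pred_mem[OF \<Gamma>]
        atomic_list_append atomic_list_shift[OF Suc.prems(1)] atomic_list_shift[OF Suc.prems(2)]
        atomic_list_coords') simp_all
  moreover have "(\<exists>z\<in>Kn n. (f e \<in> carrier G \<and> z = f e [^] m) \<and> z @ f e @ g e \<in> ?\<Gamma>) \<longleftrightarrow>
      f e \<in> carrier G \<and> g e = f e [^] Suc m" for e
  proof -
    have 1: "z @ f e @ g e \<in> ?\<Gamma> \<longleftrightarrow> g e = z \<otimes> f e" if "z \<in> carrier G" "f e \<in> carrier G" for z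
    proof -
      have len: "length x = n" if "x \<in> carrier G" for x
        using carrier_subset_Kn that by (auto simp: Kn_def)
      show ?thesis
      proof
        assume "z @ f e @ g e \<in> ?\<Gamma>"
        then show "g e = z \<otimes> f e" using that len by (auto simp: append_eq_append_conv)
      qed (use that in blast)
    qed
    have "f e [^] m \<in> carrier G \<and> f e [^] m \<in> Kn n" if "f e \<in> carrier G"
      using that carrier_subset_Kn by auto
    then show ?thesis using 1 by auto
  qed
  ultimately show ?case by (simp only:)
qed

lemma eventually_pow_chart:
  "\<forall>\<^sub>F v in nhds_Kn d v0. v \<in> V \<and> \<psi> (\<phi> v [^] (m::nat)) \<in> V \<and> \<phi> (\<psi> (\<phi> v [^] m)) = \<phi> v [^] m"
proof -
  have "filterlim (\<lambda>v. \<phi> v [^] m) (nhdsin \<tau> \<one>) (nhds_Kn d v0)"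
    using continuous_map_imp_filterlim_nhdsin[OF continuous_map_pow, of \<one>] topspace
    by (intro filterlim_compose[OF _ filterlim_\<phi>]) simp
  moreover have "openin \<tau> (\<phi> ` V)" "\<one> \<in> \<phi> ` V"
    using open_map[OF open_V] v0 by (auto intro: image_eqI[of _ _ v0])
  ultimately have "\<forall>\<^sub>F v in nhds_Kn d v0. \<phi> v [^] m \<in> \<phi> ` V"
    by (rule filterlim_eventually_in_openin)
  with eventually_V show ?thesis
    by eventually_elim (auto simp: \<psi>_\<phi>)
qed

text \<open>If one argument is \<open>v0\<close>, the identity laws make the product in the chart
  equal to the other argument. The product is therefore affine along each of the 2d coordinate lines
  through the base point, and these slopes determine the gradient.\<close>

lemma mult_chart_gradient:
  assumes "j < d"
  shows "strict_gradient (d + d) (\<lambda>z. \<psi> (\<phi> (take d z) \<otimes> \<phi> (drop d z)) ! j) (v0 @ v0)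
    (\<lambda>i. if i = j \<or> i = d + j then 1 else 0)"
proof -
  let ?F = "\<lambda>z. \<psi> (\<phi> (take d z) \<otimes> \<phi> (drop d z))" and ?a = "v0 @ v0"
  have len: "length v0 = d" using v0_Kn by (simp add: Kn_def)
  have aK: "?a \<in> Kn (d + d)" using len by (simp add: Kn_def)
  have F_left: "?F z = take d z" if "take d z \<in> V" "drop d z = v0" for z
    using that by (simp add: \<phi>_carrier v0 \<psi>_\<phi>)
  have F_right: "?F z = drop d z" if "drop d z \<in> V" "take d z = v0" for z
    using that by (simp add: \<phi>_carrier v0 \<psi>_\<phi>)
  have Fa: "?F ?a = v0" using F_left[of ?a] len v0 by simp
  have takeV: "\<forall>\<^sub>F z in nhds_Kn (d + d) ?a. take d z \<in> V"
    by (rule filterlim_eventually_in_openin[OF filterlim_take_nhds_Kn[OF v0_Kn v0_Kn] open_V v0(1)])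
  have dropV: "\<forall>\<^sub>F z in nhds_Kn (d + d) ?a. drop d z \<in> V"
    by (rule filterlim_eventually_in_openin[OF filterlim_drop_nhds_Kn[OF v0_Kn v0_Kn] open_V v0(1)])
  obtain c where c: "strict_gradient (d + d) (\<lambda>z. ?F z ! j) ?a c"
    using mult_strict_gradient[OF assms] by blast
  have "c k = (if k = j \<or> k = d + j then 1 else 0)" if k: "k < d + d" for k
  proof (rule strict_gradient_partial[OF c aK k])
    show "\<forall>\<^sub>F y in nhds_Kn (d + d) ?a. y = ?a[k := y ! k] \<longrightarrow>
        ?F y ! j - ?F ?a ! j = (if k = j \<or> k = d + j then 1 else 0) * (y ! k - ?a ! k)"
      using takeV dropV
    proof eventually_elim
      case (elim y)
      show ?case
      proof
        assume y: "y = ?a[k := y ! k]"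
        show "?F y ! j - ?F ?a ! j = (if k = j \<or> k = d + j then 1 else 0) * (y ! k - ?a ! k)"
        proof (cases "k < d")
          case True
          then have "y = v0[k := y ! k] @ v0" using y len by (simp add: list_update_append)
          then have t: "take d y = v0[k := y ! k]" "drop d y = v0"
            using len by (metis append_eq_conv_conj length_list_update)+
          have F: "?F y = v0[k := y ! k]" using F_left[of y] elim(1) t by simp
          show ?thesis unfolding F Fa using True len assms by (auto simp: nth_append nth_list_update)
        next
          case False
          then have "y = v0 @ v0[k - d := y ! k]" using y len by (simp add: list_update_append)
          then have t: "take d y = v0" "drop d y = v0[k - d := y ! k]"
            using len by (metis append_eq_conv_conj)+
          have F: "?F y = v0[k - d := y ! k]" using F_right[of y] elim(2) t by simp
          show ?thesis unfolding F Fa using False len assms k by (auto simp: nth_append nth_list_update)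
        qed
      qed
    qed
  qed
  then show ?thesis by (rule strict_gradient_coeff_cong[OF c])
qed

lemma pow_chart_v0: "\<psi> (\<phi> v0 [^] (m::nat)) = v0"
  using \<psi>_\<phi>[OF v0(1)] by (simp add: v0(2))

text \<open>The chain rule for x^(m+1) = x^m x: the gradient of component \<open>j\<close> of the
  product adds row \<open>j\<close> of the derivative of the m-th power to row \<open>j\<close> of
  the identity.\<close>

lemma pow_chart_gradient:
  assumes "j < d"
  shows "strict_gradient d (\<lambda>v. \<psi> (\<phi> v [^] (m::nat)) ! j) v0 (\<lambda>i. if i = j then of_nat m else 0)"
  using assms
proof (induction m arbitrary: j)
  case 0
  have "strict_gradient d (\<lambda>v. \<psi> (\<phi> v [^] (0::nat)) ! j) v0 (\<lambda>i. 0)"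
    using strict_gradient_const by simp
  then show ?case by (rule strict_gradient_coeff_cong) simp
next
  case (Suc m)
  let ?F = "\<lambda>z. \<psi> (\<phi> (take d z) \<otimes> \<phi> (drop d z))"
  define u where "u v = \<psi> (\<phi> v [^] m) @ v" for v
  \<comment> \<open>The rows of the derivative of \<open>u\<close>: m times the identity above the
    identity.\<close>
  define cu :: "nat \<Rightarrow> nat \<Rightarrow> 'k" where
    "cu i = (if i < d then (\<lambda>k. if k = i then of_nat m else 0) else (\<lambda>k. if k = i - d then 1 else 0))" for i
  have ev: "\<forall>\<^sub>F v in nhds_Kn d v0. length (\<psi> (\<phi> v [^] m)) = d \<and> length v = d"
    using eventually_pow_chart[of m] by eventually_elim (use V_subset_Kn in \<open>auto simp: Kn_def\<close>)
  have "strict_gradient d (\<lambda>v. ?F (u v) ! j) v0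
      (\<lambda>k. \<Sum>i<d + d. (if i = j \<or> i = d + j then 1 else 0) * cu i k)"
  proof (rule strict_gradient_compose[where u = u])
    show "v0 \<in> Kn d" by (rule v0_Kn)
    show "\<forall>\<^sub>F v in nhds_Kn d v0. u v \<in> Kn (d + d)"
      using ev by eventually_elim (simp add: u_def Kn_def)
    show "strict_gradient (d + d) (\<lambda>z. ?F z ! j) (u v0) (\<lambda>i. if i = j \<or> i = d + j then 1 else 0)"
      using mult_chart_gradient[OF Suc.prems] by (simp add: u_def pow_chart_v0)
    show "strict_gradient d (\<lambda>v. u v ! i) v0 (cu i)" if i: "i < d + d" for i
    proof (cases "i < d")
      case True
      have "\<forall>\<^sub>F v in nhds_Kn d v0. \<psi> (\<phi> v [^] m) ! i = u v ! i"
        using ev by eventually_elim (simp add: u_def nth_append True)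
      then show ?thesis using strict_gradient_cong[OF Suc.IH[OF True]] True by (simp add: cu_def)
    next
      case False
      then have i': "i - d < d" using i by simp
      have "\<forall>\<^sub>F v in nhds_Kn d v0. v ! (i - d) = u v ! i"
        using ev by eventually_elim (simp add: u_def nth_append False)
      then show ?thesis using strict_gradient_cong[OF strict_gradient_nth[OF i']] False by (simp add: cu_def)
    qed
  qed
  moreover have "\<forall>\<^sub>F v in nhds_Kn d v0. ?F (u v) ! j = \<psi> (\<phi> v [^] Suc m) ! j"
    using ev eventually_pow_chart[of m] by eventually_elim (simp add: u_def)
  ultimately have "strict_gradient d (\<lambda>v. \<psi> (\<phi> v [^] Suc m) ! j) v0
      (\<lambda>k. \<Sum>i<d + d. (if i = j \<or> i = d + j then 1 else 0) * cu i k)"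
    by (rule strict_gradient_cong)
  then show ?case
  proof (rule strict_gradient_coeff_cong)
    fix k
    have "(\<Sum>i<d + d. (if i = j \<or> i = d + j then 1 else 0) * cu i k) =
        (\<Sum>i<d + d. (if i = j then cu j k else 0) + (if i = d + j then cu (d + j) k else 0))"
      using Suc.prems by (intro sum.cong) auto
    also have "\<dots> = cu j k + cu (d + j) k"
      using Suc.prems by (simp add: sum.distrib)
    also have "\<dots> = (if k = j then of_nat (Suc m) else 0)"
      using Suc.prems by (simp add: cu_def)
    finally show "(\<Sum>i<d + d. (if i = j \<or> i = d + j then 1 else 0) * cu i k) = (if k = j then of_nat (Suc m) else 0)" .
  qed
qed

text \<open>\<psi> is given without definability, but on the ball its value \<open>w\<close> is
  characterised by \<phi> w = (\<phi> x)^m, as \<phi> is injective on \<open>V\<close>; so the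
  graphs of \<phi> and of the power map suffice.\<close>

lemma definable_pow_epigraph:
  assumes V: "\<And>x. x \<in> Kn d \<Longrightarrow> l1_dist d x v0 \<le> r \<Longrightarrow>
      x \<in> V \<and> \<psi> (\<phi> x [^] (m::nat)) \<in> V \<and> \<phi> (\<psi> (\<phi> x [^] m)) = \<phi> x [^] m"
  shows "definable M (Suc d) {x @ [s] | x s. x \<in> Kn d \<and> l1_dist d x v0 \<le> r \<and>
      l1_dist d (\<psi> (\<phi> x [^] m)) y \<le> s \<and> s \<le> r}" (is "definable M (Suc d) ?C")
proof (rule definable_if_definable_pred)
  show "?C \<subseteq> Kn (Suc d)" by (auto simp: Kn_def)
  let ?\<Gamma> = "{v @ \<phi> v | v. v \<in> V}"
  \<comment> \<open>This name protects the conjunction from being split by the introduction rules;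
    \<open>definable_pred_pow\<close> treats it as a whole.\<close>
  define R where "R g h \<longleftrightarrow> g \<in> carrier G \<and> h = g [^] m" for g h
  define Q where "Q x s \<longleftrightarrow> (l1_dist d x v0 \<le> r \<and> s \<le> r) \<and>
      (\<exists>w\<in>Kn d. \<exists>g\<in>Kn n. \<exists>h\<in>Kn n. (x @ g \<in> ?\<Gamma> \<and> w @ h \<in> ?\<Gamma>) \<and> R g h \<and> l1_dist d w y \<le> s)" for x s
  have Q: "x @ [s] \<in> ?C \<longleftrightarrow> Q x s" if x: "x \<in> Kn d" for x s
  proof -
    have \<Gamma>: "w @ g \<in> ?\<Gamma> \<longleftrightarrow> w \<in> V \<and> g = \<phi> w" if "w \<in> Kn d" for w g
    proof -
      have "length v = length w" if "v \<in> V" for v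
        using that V_subset_Kn \<open>w \<in> Kn d\<close> by (auto simp: Kn_def)
      then show ?thesis by (auto simp: append_eq_append_conv)
    qed
    have \<phi>K: "\<phi> w \<in> Kn n" if "w \<in> V" for w
      using that \<phi>_carrier carrier_subset_Kn by blast
    show ?thesis
    proof
      assume "x @ [s] \<in> ?C"
      then have *: "l1_dist d x v0 \<le> r" "l1_dist d (\<psi> (\<phi> x [^] m)) y \<le> s" "s \<le> r" by auto
      note Vx = V[OF x *(1)]
      let ?w = "\<psi> (\<phi> x [^] m)"
      have "?w \<in> Kn d" using Vx V_subset_Kn by blast
      moreover have "x @ \<phi> x \<in> ?\<Gamma> \<and> ?w @ \<phi> ?w \<in> ?\<Gamma>" using Vx by blast
      moreover have "R (\<phi> x) (\<phi> ?w)" using Vx \<phi>_carrier by (simp add: R_def)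
      ultimately show "Q x s" unfolding Q_def using * Vx \<phi>K by blast
    next
      assume "Q x s"
      then obtain w g h where *: "l1_dist d x v0 \<le> r" "s \<le> r" "w \<in> Kn d" "x @ g \<in> ?\<Gamma>" "w @ h \<in> ?\<Gamma>"
          "R g h" "l1_dist d w y \<le> s"
        unfolding Q_def by blast
      then have "w \<in> V" "\<phi> w = \<phi> x [^] m" using \<Gamma>[OF x] \<Gamma>[OF *(3)] by (auto simp: R_def)
      then have "\<psi> (\<phi> x [^] m) = w" using \<psi>_\<phi> by metis
      then show "x @ [s] \<in> ?C" using * x by simp
    qed
  qed
  have "definable_pred M (\<lambda>e. Q (map e [0..<d]) (e d))"
    unfolding Q_def
  proof (intro definable_pred_conj definable_pred_ex_list)
    show "definable_pred M (\<lambda>e. l1_dist d (map e [0..<d]) v0 \<le> r)"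
      by (intro definable_pred_le definable_fun_l1_dist definable_fun_atomic) auto
    show "definable_pred M (\<lambda>e. e d \<le> r)"
      by (intro definable_pred_le definable_fun_atomic) auto
    \<comment> \<open>Below the three quantifiers the environment lists h, g, w, x and s in this
      order, with lengths n, n, d, d and 1.\<close>
    show "definable_pred M (\<lambda>e. map (\<lambda>i. e (i + d + n + n)) [0..<d] @ map (\<lambda>i. e (i + n)) [0..<n] \<in> ?\<Gamma>)"
      by (intro definable_pred_mem[OF definable_\<phi>] atomic_list_append atomic_list_coords) auto
    show "definable_pred M (\<lambda>e. map (\<lambda>i. e (i + n + n)) [0..<d] @ map e [0..<n] \<in> ?\<Gamma>)"
      by (intro definable_pred_mem[OF definable_\<phi>] atomic_list_append atomic_list_coords atomic_list_coords') auto
    show "definable_pred M (\<lambda>e. R (map (\<lambda>i. e (i + n)) [0..<n]) (map e [0..<n]))"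
      unfolding R_def by (intro definable_pred_pow atomic_list_coords atomic_list_coords') auto
    show "definable_pred M (\<lambda>e. l1_dist d (map (\<lambda>i. e (i + n + n)) [0..<d]) y \<le> e (d + d + n + n))"
      by (intro definable_pred_le definable_fun_l1_dist definable_fun_atomic) auto
  qed
  moreover have "map e [0..<Suc d] \<in> ?C \<longleftrightarrow> Q (map e [0..<d]) (e d)" for e
    using Q[of "map e [0..<d]" "e d"] by (simp add: Kn_def)
  ultimately show "definable_pred M (\<lambda>e. map e [0..<Suc d] \<in> ?C)" by (simp only:)
qed

lemma eventually_pow_preimage:
  assumes "definably_complete M" "0 < (m::nat)"
  shows "\<forall>\<^sub>F v in nhds_Kn d v0. v \<in> V \<and> (\<exists>g\<in>carrier G. \<phi> v = g [^] m)"
proof -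
  obtain \<rho> where "0 < \<rho>" and \<rho>: "\<And>x. x \<in> Kn d \<Longrightarrow> l1_dist d x v0 < \<rho> \<Longrightarrow>
      x \<in> V \<and> \<psi> (\<phi> x [^] m) \<in> V \<and> \<phi> (\<psi> (\<phi> x [^] m)) = \<phi> x [^] m"
    using eventually_pow_chart[of m] unfolding eventually_nhds_Kn[OF v0_Kn] by blast
  have "\<forall>\<^sub>F y in nhds_Kn d v0. \<exists>x\<in>Kn d. l1_dist d x v0 < \<rho> \<and> \<psi> (\<phi> x [^] m) = y"
  proof (rule strict_gradient_locally_surj[OF assms v0_Kn pow_chart_v0 _ pow_chart_gradient \<open>0 < \<rho>\<close>])
    show "\<forall>\<^sub>F x in nhds_Kn d v0. \<psi> (\<phi> x [^] m) \<in> Kn d"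
      using eventually_pow_chart[of m] by eventually_elim (use V_subset_Kn in blast)
  qed (auto intro!: definable_pow_epigraph \<rho>[THEN conjunct1] \<rho>[THEN conjunct2, THEN conjunct1]
      \<rho>[THEN conjunct2, THEN conjunct2] elim: le_less_trans)
  with eventually_V show ?thesis
  proof eventually_elim
    case (elim y)
    then obtain x where x: "x \<in> Kn d" "l1_dist d x v0 < \<rho>" "\<psi> (\<phi> x [^] m) = y" by blast
    then have "\<phi> y = \<phi> x [^] m" "\<phi> x \<in> carrier G" using \<rho>[of x] \<phi>_carrier by auto
    with elim show ?case by blast
  qed
qed

lemma pow_image_openin:
  assumes "definably_complete M" "0 < (m::nat)"
  obtains S where "openin \<tau> S" "\<one> \<in> S" "S \<subseteq> (\<lambda>x. x [^] m) ` carrier G"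
proof -
  obtain T where T: "openin (Kn_top d) T" "v0 \<in> T"
      "\<And>v. v \<in> T \<Longrightarrow> v \<in> V \<and> (\<exists>g\<in>carrier G. \<phi> v = g [^] m)"
    using eventually_pow_preimage[OF assms] v0_Kn unfolding eventually_nhdsin by auto
  show thesis
  proof (rule that)
    show "openin \<tau> (\<phi> ` T)" using T by (intro open_map) auto
    show "\<one> \<in> \<phi> ` T" using T(2) v0(2) by (metis image_eqI)
    show "\<phi> ` T \<subseteq> (\<lambda>x. x [^] m) ` carrier G" using T(3) by auto
  qed
qed

lemma definable_pow_image: "definable M n ((\<lambda>x. x [^] (m::nat)) ` carrier G)"
proof (rule definable_if_definable_pred)
  have "definable_pred M (\<lambda>e. \<exists>x\<in>Kn n. x \<in> carrier G \<and> map e [0..<n] = x [^] m)"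
    by (intro definable_pred_ex_list definable_pred_pow atomic_list_coords atomic_list_coords') auto
  moreover have "(\<exists>x\<in>Kn n. x \<in> carrier G \<and> map e [0..<n] = x [^] m) \<longleftrightarrow>
      map e [0..<n] \<in> (\<lambda>x. x [^] m) ` carrier G" for e
    using carrier_subset_Kn by auto
  ultimately show "definable_pred M (\<lambda>e. map e [0..<n] \<in> (\<lambda>x. x [^] m) ` carrier G)"
    by (simp only:)
  show "(\<lambda>x. x [^] m) ` carrier G \<subseteq> Kn n" using carrier_subset_Kn by auto
qed

end

section \<open>From local surjectivity to the whole group\<close>

text \<open>Commutativity makes the power map a homomorphism, so its image H is a subgroup.
  Translating a neighbourhood of the identity inside H by \<open>g\<close> gives a neighbourhood of
  \<open>g\<close> inside the coset g H. Hence H and its complement, both unions of cosets, are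
  open.\<close>

lemma pow_image_clopen:
  assumes "group_chart G M n \<tau> d V \<phi> \<psi> v0" "comm_group G" "definably_complete M" "0 < (m::nat)"
  shows "openin \<tau> ((\<lambda>x. x [^]\<^bsub>G\<^esub> m) ` carrier G)" "closedin \<tau> ((\<lambda>x. x [^]\<^bsub>G\<^esub> m) ` carrier G)"
proof -
  interpret group_chart G M n \<tau> d V \<phi> \<psi> v0 by (rule assms(1))
  interpret comm_group G by (rule assms(2))
  let ?H = "(\<lambda>x. x [^]\<^bsub>G\<^esub> m) ` carrier G"
  have H: "subgroup ?H G"
  proof (rule subgroupI)
    show "inv\<^bsub>G\<^esub> a \<in> ?H" if "a \<in> ?H" for a
      using that by (auto simp: nat_pow_inv[symmetric])
    show "a \<otimes>\<^bsub>G\<^esub> b \<in> ?H" if "a \<in> ?H" "b \<in> ?H" for a b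
      using that by (auto simp: pow_mult_distrib[OF m_comm, symmetric])
  qed auto
  obtain S where S: "openin \<tau> S" "\<one>\<^bsub>G\<^esub> \<in> S" "S \<subseteq> ?H" by (rule pow_image_openin[OF assms(3,4)])
  have HG: "?H \<subseteq> carrier G" by auto
  have nbhd: "\<exists>T. openin \<tau> T \<and> g \<in> T \<and> T \<subseteq> (\<lambda>x. g \<otimes>\<^bsub>G\<^esub> x) ` ?H" if "g \<in> carrier G" for g
    using openin_left_translate[OF S(1) that] S(2,3) that
    by (intro exI[of _ "(\<lambda>x. g \<otimes>\<^bsub>G\<^esub> x) ` S"]) (auto intro: image_eqI[of _ _ "\<one>\<^bsub>G\<^esub>"])
  show "openin \<tau> ?H"
  proof (subst openin_subopen, rule ballI)
    fix g assume g: "g \<in> ?H"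
    have "(\<lambda>x. g \<otimes>\<^bsub>G\<^esub> x) ` ?H \<subseteq> ?H"
      by (rule image_subsetI) (rule subgroup.m_closed[OF H g])
    then show "\<exists>T. openin \<tau> T \<and> g \<in> T \<and> T \<subseteq> ?H"
      using nbhd[OF subsetD[OF HG g]] by (meson order_trans)
  qed
  have "openin \<tau> (carrier G - ?H)"
  proof (subst openin_subopen, rule ballI)
    fix g assume g: "g \<in> carrier G - ?H"
    have "g \<otimes>\<^bsub>G\<^esub> h \<in> carrier G - ?H" if h: "h \<in> ?H" for h
    proof -
      have hG: "h \<in> carrier G" using h HG by blast
      have "g = (g \<otimes>\<^bsub>G\<^esub> h) \<otimes>\<^bsub>G\<^esub> inv\<^bsub>G\<^esub> h" using g hG by (simp add: m_assoc)
      then have "g \<otimes>\<^bsub>G\<^esub> h \<notin> ?H"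
        using subgroup.m_closed[OF H _ subgroup.m_inv_closed[OF H h]] g by (metis DiffD2)
      then show ?thesis using g hG by simp
    qed
    then have "(\<lambda>x. g \<otimes>\<^bsub>G\<^esub> x) ` ?H \<subseteq> carrier G - ?H" by (rule image_subsetI)
    then show "\<exists>T. openin \<tau> T \<and> g \<in> T \<and> T \<subseteq> carrier G - ?H"
      using nbhd[OF DiffD1[OF g]] by (meson order_trans)
  qed
  then show "closedin \<tau> ?H" using HG topspace by (simp add: closedin_def)
qed

theorem theorem1p3:
  fixes M :: "('f, 'r, 'k::linordered_field) expansion"
    and n :: nat
    and G :: "('k list, 'm) monoid_scheme"
  assumes "d_minimal M"
    and "definable_group M n G"
    and "comm_group G"
    and "definably_connected_group M n G"
  shows "divisible_group G"
proof -
  interpret comm_group G by (rule assms(3))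
  have M: "definably_complete M" using assms(1) by (simp add: d_minimal_def)
  obtain \<tau> where "is_group_manifold_topology M n G \<tau>"
    and connected: "\<And>S. definable M n S \<and> openin \<tau> S \<and> closedin \<tau> S \<Longrightarrow> S = {} \<or> S = carrier G"
    using assms(4) unfolding definably_connected_group_def by blast
  then obtain A where "Ck_group_manifold M 1 n G \<tau> A"
    unfolding is_group_manifold_topology_def by blast
  then obtain d V \<phi> \<psi> v0 where chart: "group_chart G M n \<tau> d V \<phi> \<psi> v0"
    using group_chart_exists[OF assms(2)] by blast
  \<comment> \<open>An empty image would mean an empty carrier, so both alternatives offered by
    connectedness give the equation.\<close>
  have "(\<lambda>x. x [^]\<^bsub>G\<^esub> m) ` carrier G = carrier G" if "0 < m" for m :: nat
    using connected[of "(\<lambda>x. x [^]\<^bsub>G\<^esub> m) ` carrier G"] group_chart.definable_pow_image[OF chart]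
      pow_image_clopen[OF chart assms(3) M that] by blast
  then show ?thesis unfolding divisible_group_def by (metis (no_types, lifting) imageE)
qed

end
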